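(* Let $\mathcal H,\mathcal K$ be complex Hilbert spaces and let $A,B\in L(\mathcal H,\mathcal K)$. The following conditions are equivalent: 1. $A\overset{-}{\leq}B$ (minus order); 2. $B$ is $(\overline{R(A^* )},\overline{R(A)})$-complementable and $B_{/\overline{R(A^* )},\overline{R(A)}}=A$.
   Context: $L(\mathcal H,\mathcal K)$ is the set of bounded linear operators from $\mathcal H$ to $\mathcal K$, $L(\mathcal H)=L(\mathcal H,\mathcal H)$; $R(T)$ and $N(T)$ are the range and nullspace of $T$; $|T|=(T^*T)^{1/2}$; $T^\dagger$ is the (possibly unbounded) Moore-Penrose inverse. A projection is a bounded idempotent operator (not necessarily orthogonal). Minus order: $A\overset{-}{\leq}B$ if there are projections $\tilde Q\in L(\mathcal K)$ and $Q\in L(\mathcal H)$ such that $A=\tilde QB=BQ$. Complementability and bilateral shorted operator: let $T\in L(\mathcal H,\mathcal K)$ and let $\mathcal S\subseteq\mathcal H$, $\mathcal T\subseteq\mathcal K$ be closed subspaces. Write $T=\begin{pmatrix} b&c\\ d&e\end{pmatrix}$ with respect to $\mathcal H=\mathcal S\oplus\mathcal S^\perp$ and $\mathcal K=\mathcal T\oplus\mathcal T^\perp$. $T$ is $(\mathcal S,\mathcal T)$-weakly complementable if $R(c^* )\subseteq R(|e|^{1/2})$ and $R(d)\subseteq R(|e^*|^{1/2})$; in this case the bilateral shorted operator of $T$ to $\mathcal S,\mathcal T$ is $$T_{/\mathcal S,\mathcal T}=\begin{pmatrix} b-g^*f&0\\0&0\end{pmatrix},\qquad f=(|e^*|^{1/2}u)^\dagger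 d,\quad g=(|e|^{1/2})^\dagger c^*,$$ where $e=|e^*|u$ is the polar decomposition of $e$. $T$ is $(\mathcal S,\mathcal T)$-complementable if the stronger conditions $R(c^* )\subseteq R(e^* )$ and $R(d)\subseteq R(e)$ hold (these imply weak complementability, so $T_{/\mathcal S,\mathcal T}$ is defined). *)

theory Defs
  imports "HOL-Analysis.Analysis"
begin

section \<open>Complex Hilbert spaces\<close>

text \<open>A complex Hilbert space is presented on top of its underlying real Hilbert space.  The last
  axiom makes the form positive definite and the norm the one induced by it,
  \<open>norm x = sqrt (Re (cinner x x))\<close>.  The form is linear in the first argument.\<close>

class chilbert_space = real_inner + banach +
  fixes scaleC :: "complex \<Rightarrow> 'a \<Rightarrow> 'a"
    and cinner :: "'a \<Rightarrow> 'a \<Rightarrow> complex"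
  assumes scaleC_add_right: "scaleC c (x + y) = scaleC c x + scaleC c y"
    and scaleC_add_left: "scaleC (c + d) x = scaleC c x + scaleC d x"
    and scaleC_scaleC: "scaleC c (scaleC d x) = scaleC (c * d) x"
    and scaleC_of_real: "scaleC (complex_of_real r) x = r *\<^sub>R x"
    and cinner_commute: "cinner x y = cnj (cinner y x)"
    and cinner_add_left: "cinner (x + y) z = cinner x z + cinner y z"
    and cinner_scaleC_left: "cinner (scaleC c x) y = c * cinner x y"
    and inner_eq_Re_cinner: "inner x y = Re (cinner x y)"

instantiation complex :: chilbert_space
begin

definition scaleC_complex :: "complex \<Rightarrow> complex \<Rightarrow> complex"
  where "scaleC_complex c x = c * x"

definition cinner_complex :: "complex \<Rightarrow> complex \<Rightarrow> complex"
  where "cinner_complex x y = x * cnj y"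

instance
  by standard
    (simp_all add: scaleC_complex_def cinner_complex_def inner_complex_def algebra_simps
      scaleR_conv_of_real)

end

lemma cinner_self_eq_norm:
  fixes x :: "'a::chilbert_space"
  shows "cinner x x = complex_of_real ((norm x)\<^sup>2)"
proof (rule complex_eqI)
  show "Re (cinner x x) = Re (complex_of_real ((norm x)\<^sup>2))"
    by (simp add: inner_eq_Re_cinner[symmetric] power2_norm_eq_inner)
  have "Im (cinner x x) = Im (cnj (cinner x x))"
    using cinner_commute[of x x] by (rule arg_cong)
  then show "Im (cinner x x) = Im (complex_of_real ((norm x)\<^sup>2))"
    by simp
qed

section \<open>Bounded operators\<close>

definition bounded_clinear :: "('a::chilbert_space \<Rightarrow> 'b::chilbert_space) \<Rightarrow> bool"
  where "bounded_clinear T \<longleftrightarrow> bounded_linear T \<and> (\<forall>c x. T (scaleC c x) = scaleC c (T x))"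

definition nullspace :: "('a \<Rightarrow> 'b::zero) \<Rightarrow> 'a set"
  where "nullspace T = {x. T x = 0}"

definition orth :: "'a::chilbert_space set \<Rightarrow> 'a set"
  where "orth S = {x. \<forall>y\<in>S. cinner x y = 0}"

text \<open>The orthogonal projection onto a closed subspace.\<close>

definition orth_proj :: "'a::chilbert_space set \<Rightarrow> 'a \<Rightarrow> 'a"
  where "orth_proj S x = (THE p. p \<in> S \<and> x - p \<in> orth S)"

definition adj :: "('a::chilbert_space \<Rightarrow> 'b::chilbert_space) \<Rightarrow> 'b \<Rightarrow> 'a"
  where "adj T = (THE R. \<forall>x y. cinner (T x) y = cinner x (R y))"

text \<open>Over the complex field the second condition already implies self-adjointness.\<close>

definition positive_op :: "('a::chilbert_space \<Rightarrow> 'a) \<Rightarrow> bool"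
  where "positive_op T \<longleftrightarrow>
    bounded_clinear T \<and> (\<forall>x. Im (cinner (T x) x) = 0 \<and> 0 \<le> Re (cinner (T x) x))"

definition sqrt_op :: "('a::chilbert_space \<Rightarrow> 'a) \<Rightarrow> 'a \<Rightarrow> 'a"
  where "sqrt_op T = (THE R. positive_op R \<and> R \<circ> R = T)"

definition abs_op :: "('a::chilbert_space \<Rightarrow> 'b::chilbert_space) \<Rightarrow> 'a \<Rightarrow> 'a"
  where "abs_op T = sqrt_op (adj T \<circ> T)"

definition partial_isometry :: "('a::chilbert_space \<Rightarrow> 'b::chilbert_space) \<Rightarrow> bool"
  where "partial_isometry U \<longleftrightarrow>
    bounded_clinear U \<and> (\<forall>x\<in>orth (nullspace U). norm (U x) = norm x)"

text \<open>The partial isometry of the polar decomposition \<open>T = |T\<^sup>*| U\<close>.  It is the same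
  operator as in \<open>T = U |T|\<close>: the conditions below force its final space to be the closure of the
  range of \<open>T\<close>.\<close>

definition polar_factor :: "('a::chilbert_space \<Rightarrow> 'b::chilbert_space) \<Rightarrow> 'a \<Rightarrow> 'b"
  where "polar_factor T =
    (THE U. partial_isometry U \<and> nullspace U = nullspace T \<and> T = abs_op (adj T) \<circ> U)"

text \<open>The possibly unbounded Moore-Penrose inverse, whose domain is the sum of the range of \<open>T\<close> and
  the orthogonal complement of that range.  On this domain the value is the unique \<open>x\<close> orthogonal to
  the nullspace for which \<open>T x\<close> is the component of \<open>y\<close> in the range; outside it the value is
  unspecified.\<close>

definition moore_penrose :: "('a::chilbert_space \<Rightarrow> 'b::chilbert_space) \<Rightarrow> 'b \<Rightarrow> 'a"
  where "moore_penrose T y = (THE x. x \<in> orth (nullspace T) \<and> y - T x \<in> orth (range T))"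

section \<open>Minus order\<close>

text \<open>Projections are bounded idempotents, not necessarily orthogonal.\<close>

definition projection :: "('a::chilbert_space \<Rightarrow> 'a) \<Rightarrow> bool"
  where "projection Q \<longleftrightarrow> bounded_clinear Q \<and> Q \<circ> Q = Q"

definition minus_le ::
    "('a::chilbert_space \<Rightarrow> 'b::chilbert_space) \<Rightarrow> ('a \<Rightarrow> 'b) \<Rightarrow> bool"
  where "minus_le A B \<longleftrightarrow>
    (\<exists>Q' Q. projection Q' \<and> projection Q \<and> A = Q' \<circ> B \<and> A = B \<circ> Q)"

section \<open>Complementability and bilateral shorted operators\<close>

text \<open>\<open>block X Y T\<close> is the entry of the operator matrix of \<open>T\<close> mapping the closed subspace \<open>X\<close> of the
  domain to the closed subspace \<open>Y\<close> of the codomain.  It is extended by \<open>0\<close> on the orthogonal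
  complement of \<open>X\<close> and regarded as an operator between the whole spaces.  This embedding of the
  bounded operators from \<open>X\<close> to \<open>Y\<close> preserves ranges, sums and products and commutes with adjoints,
  square roots and moduli.  It also commutes with the polar decomposition and the Moore-Penrose
  inverse, because the nullspace of the extension is the original nullspace plus the orthogonal
  complement of \<open>X\<close>.\<close>

definition block ::
    "'a::chilbert_space set \<Rightarrow> 'b::chilbert_space set \<Rightarrow> ('a \<Rightarrow> 'b) \<Rightarrow> 'a \<Rightarrow> 'b"
  where "block X Y T = orth_proj Y \<circ> T \<circ> orth_proj X"

text \<open>In the definitions below \<open>b\<close>, \<open>c\<close>, \<open>d\<close>, \<open>e\<close> are the entries of the operator matrix of \<open>T\<close>
  relative to the decompositions of the domain by \<open>S\<close> and of the codomain by \<open>V\<close>.\<close>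

definition weakly_complementable ::
    "'a::chilbert_space set \<Rightarrow> 'b::chilbert_space set \<Rightarrow> ('a \<Rightarrow> 'b) \<Rightarrow> bool"
  where "weakly_complementable S V T \<longleftrightarrow>
    (let c = block (orth S) V T;
         d = block S (orth V) T;
         e = block (orth S) (orth V) T
     in range (adj c) \<subseteq> range (sqrt_op (abs_op e)) \<and>
        range d \<subseteq> range (sqrt_op (abs_op (adj e))))"

definition complementable ::
    "'a::chilbert_space set \<Rightarrow> 'b::chilbert_space set \<Rightarrow> ('a \<Rightarrow> 'b) \<Rightarrow> bool"
  where "complementable S V T \<longleftrightarrow>
    (let c = block (orth S) V T;
         d = block S (orth V) T;
         e = block (orth S) (orth V) T
     in range (adj c) \<subseteq> range (adj e) \<and> range d \<subseteq> range e)"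

text \<open>Meaningful when \<open>T\<close> is weakly complementable: then \<open>d\<close> and \<open>adj c\<close> map into the ranges of the
  operators whose Moore-Penrose inverses are applied, and \<open>f\<close>, \<open>g\<close> are bounded operators.  The
  matrix with the single nonzero entry \<open>b - g\<^sup>* f\<close> is that entry itself, extended by \<open>0\<close>.\<close>

definition shorted ::
    "'a::chilbert_space set \<Rightarrow> 'b::chilbert_space set \<Rightarrow> ('a \<Rightarrow> 'b) \<Rightarrow> 'a \<Rightarrow> 'b"
  where "shorted S V T =
    (let b = block S V T;
         c = block (orth S) V T;
         d = block S (orth V) T;
         e = block (orth S) (orth V) T;
         u = polar_factor e;
         f = moore_penrose (sqrt_op (abs_op (adj e)) \<circ> u) \<circ> d;
         g = moore_penrose (sqrt_op (abs_op e)) \<circ> adj c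
     in (\<lambda>x. b x - adj g (f x)))"

end

theory Submission
  imports Defs
begin

text \<open>Write \<open>b, c, d, e\<close> for the blocks of \<open>B\<close> relative to \<open>S\<close>, the closure of \<open>R(A\<^sup>*)\<close>, and \<open>V\<close>,
  the closure of \<open>R(A)\<close>.  If \<open>d = e X\<close> and \<open>c = Y e\<close> with bounded \<open>X\<close> and \<open>Y\<close>, then the polar
  decomposition \<open>e = u |e|\<close> gives \<open>f = |e|\<^sup>1\<^sup>/\<^sup>2 X\<close> and \<open>g\<^sup>* = Y u |e|\<^sup>1\<^sup>/\<^sup>2\<close>, so the shorted operator is
  \<open>b - Y e X = b - c X\<close>.  Given \<open>A = Q' B = B Q\<close>, such factors are \<open>X = (1 - Q) P\<^sub>S\<close> and
  \<open>Y = P\<^sub>V (1 - Q')\<close>, and \<open>b - c X = P\<^sub>V B Q P\<^sub>S = A\<close>.  Conversely, Douglas' lemma turns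
  complementability into such factors, and \<open>P\<^sub>S - P X P\<^sub>S\<close> and \<open>P\<^sub>V - P\<^sub>V Y P'\<close>, with \<open>P\<close> and \<open>P'\<close> the
  orthogonal projections onto the complements of \<open>S\<close> and \<open>V\<close>, are idempotents realizing the minus
  order.\<close>

section \<open>Complex inner products\<close>

lemma scaleC_minus_one: "scaleC (- 1) x = - (x::'a::chilbert_space)"
  using scaleC_of_real[of "- 1" x] by simp

lemma scaleC_zero_right: "scaleC c 0 = (0::'a::chilbert_space)"
  using scaleC_add_right[of c 0 "0::'a"] by simp

lemma scaleC_minus_right: "scaleC c (- x) = - scaleC c (x::'a::chilbert_space)"
  using scaleC_add_right[of c x "- x"] by (simp add: scaleC_zero_right eq_neg_iff_add_eq_0 add.commute)

lemma scaleC_diff_right: "scaleC c (x - y) = scaleC c x - scaleC c (y::'a::chilbert_space)"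
  using scaleC_add_right[of c x "- y"] by (simp add: scaleC_minus_right)

lemma scaleC_scaleR: "scaleC c (r *\<^sub>R x) = r *\<^sub>R scaleC c (x::'a::chilbert_space)"
  by (simp add: scaleC_of_real[symmetric] scaleC_scaleC mult.commute)

text \<open>For a real-linear map, this reduces complex homogeneity to compatibility with the single
  scalar \<open>\<i>\<close>.\<close>

lemma scaleC_conv_scaleR: "scaleC c x = Re c *\<^sub>R x + Im c *\<^sub>R scaleC \<i> (x::'a::chilbert_space)"
proof -
  have "scaleC c x = scaleC (of_real (Re c) + of_real (Im c) * \<i>) x"
    by (metis complex_eq mult.commute)
  then show ?thesis
    by (simp only: scaleC_add_left scaleC_scaleC[symmetric] scaleC_of_real)
qed

lemma cinner_add_right:
  "cinner x (y + z) = cinner x y + cinner x (z::'a::chilbert_space)"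
  using cinner_commute[of x "y + z"] cinner_commute[of x y] cinner_commute[of x z]
  by (simp add: cinner_add_left)

lemma cinner_scaleC_right:
  "cinner x (scaleC c y) = cnj c * cinner x (y::'a::chilbert_space)"
  using cinner_commute[of x "scaleC c y"] cinner_commute[of x y]
  by (simp add: cinner_scaleC_left)

lemma Im_cinner: "Im (cinner x y) = inner x (scaleC \<i> (y::'a::chilbert_space))"
  by (simp add: inner_eq_Re_cinner cinner_scaleC_right)

text \<open>The real inner product and multiplication by \<open>\<i>\<close> determine the complex
  form, so most later arguments can work with \<open>inner\<close> alone.\<close>

lemma cinner_eq_Complex:
  "cinner x y = Complex (inner x y) (inner x (scaleC \<i> (y::'a::chilbert_space)))"
  by (simp add: complex_eq_iff Im_cinner inner_eq_Re_cinner)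

lemma inner_scaleC_i_left:
  "inner (scaleC \<i> x) y = - inner x (scaleC \<i> (y::'a::chilbert_space))"
  by (simp add: inner_eq_Re_cinner cinner_scaleC_right cinner_scaleC_left)

lemma norm_scaleC: "norm (scaleC c x) = cmod c * norm (x::'a::chilbert_space)"
proof -
  have "complex_of_real ((norm (scaleC c x))\<^sup>2) = c * cnj c * of_real ((norm x)\<^sup>2)"
    unfolding cinner_self_eq_norm[symmetric] by (simp add: cinner_scaleC_left cinner_scaleC_right)
  also have "\<dots> = complex_of_real ((cmod c * norm x)\<^sup>2)"
    by (simp only: complex_norm_square[symmetric] power_mult_distrib of_real_mult)
  finally have "(norm (scaleC c x))\<^sup>2 = (cmod c * norm x)\<^sup>2"
    using of_real_eq_iff by blast
  then show ?thesis
    by (simp add: power2_eq_iff_nonneg)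
qed

lemma bounded_linear_scaleC: "bounded_linear (scaleC c :: 'a \<Rightarrow> 'a::chilbert_space)"
  by (rule bounded_linear_intro[of _ "cmod c"])
    (simp_all add: scaleC_add_right scaleC_scaleR norm_scaleC mult.commute)

lemmas tendsto_scaleC = bounded_linear.tendsto[OF bounded_linear_scaleC]

section \<open>Bounded complex-linear maps\<close>

lemma bounded_clinearI:
  assumes "\<And>x y. T (x + y) = T x + T y" "\<And>c x. T (scaleC c x) = scaleC c (T x)"
    "\<And>x. norm (T x) \<le> K * norm x"
  shows "bounded_clinear T"
  unfolding bounded_clinear_def
proof (intro conjI allI bounded_linear_intro)
  show "T (r *\<^sub>R x) = r *\<^sub>R T x" for r x
    using assms(2)[of "of_real r" x] by (simp add: scaleC_of_real)
  show "norm (T x) \<le> norm x * K" for x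
    using assms(3)[of x] by (simp add: mult.commute)
qed (use assms in auto)

lemma bounded_clinear_bounded_linear: "bounded_clinear T \<Longrightarrow> bounded_linear T"
  by (simp add: bounded_clinear_def)

lemma
  assumes "bounded_clinear T"
  shows clin_add: "T (x + y) = T x + T y"
    and clin_diff: "T (x - y) = T x - T y"
    and clin_zero: "T 0 = 0"
    and clin_scaleC: "T (scaleC c x) = scaleC c (T x)"
    and clin_scaleR: "T (r *\<^sub>R x) = r *\<^sub>R T x"
  using assms unfolding bounded_clinear_def
  by (auto simp: bounded_linear.linear linear_add linear_diff linear_0 linear_cmul)

lemma clin_bound:
  assumes "bounded_clinear T"
  obtains K where "K > 0" "\<And>x. norm (T x) \<le> K * norm x"
  using bounded_linear.pos_bounded[OF bounded_clinear_bounded_linear[OF assms]]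
  by (auto simp: mult.commute)

lemma clin_tendsto: "bounded_clinear T \<Longrightarrow> (f \<longlongrightarrow> l) F \<Longrightarrow> ((\<lambda>x. T (f x)) \<longlongrightarrow> T l) F"
  by (rule bounded_linear.tendsto[OF bounded_clinear_bounded_linear])

lemma clin_continuous_on: "bounded_clinear T \<Longrightarrow> continuous_on X T"
  by (rule bounded_linear.continuous_on[OF bounded_clinear_bounded_linear continuous_on_id])

lemma bounded_clinear_compose:
  assumes "bounded_clinear S" "bounded_clinear T"
  shows "bounded_clinear (S \<circ> T)"
  using assms bounded_linear_compose[of S T] unfolding bounded_clinear_def by (simp add: o_def)

lemma bounded_clinear_id: "bounded_clinear (\<lambda>x. x)"
  by (simp add: bounded_clinear_def bounded_linear_ident)

lemma bounded_clinear_scaleR: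
  assumes "bounded_clinear S"
  shows "bounded_clinear (\<lambda>x. r *\<^sub>R S x)"
  using assms unfolding bounded_clinear_def
  by (simp add: bounded_linear_const_scaleR scaleC_scaleR)

lemma bounded_clinear_diff:
  assumes "bounded_clinear S" "bounded_clinear T"
  shows "bounded_clinear (\<lambda>x. S x - T x)"
  using assms bounded_linear_sub[of S T] unfolding bounded_clinear_def by (simp add: scaleC_diff_right)

section \<open>Orthogonal projections\<close>

text \<open>\<open>subspace\<close> refers to the real scalars, so closure under complex scalars is
  a separate condition.\<close>

definition csubspace :: "'a::chilbert_space set \<Rightarrow> bool"
  where "csubspace S \<longleftrightarrow> subspace S \<and> (\<forall>c. \<forall>x\<in>S. scaleC c x \<in> S)"

lemma csubspace_subspace: "csubspace S \<Longrightarrow> subspace S"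
  by (simp add: csubspace_def)

lemma csubspaceI:
  assumes "0 \<in> S" "\<And>x y. x \<in> S \<Longrightarrow> y \<in> S \<Longrightarrow> x + y \<in> S"
    "\<And>c x. x \<in> S \<Longrightarrow> scaleC c x \<in> S"
  shows "csubspace S"
  unfolding csubspace_def subspace_def using assms scaleC_of_real by metis

lemma csubspace_range:
  assumes "bounded_clinear T"
  shows "csubspace (range T)"
proof (rule csubspaceI)
  show "0 \<in> range T"
    using clin_zero[OF assms] by (metis rangeI)
  show "x + y \<in> range T" if "x \<in> range T" "y \<in> range T" for x y
    using that by (auto simp: clin_add[OF assms, symmetric])
  show "scaleC c x \<in> range T" if "x \<in> range T" for c x
    using that by (auto simp: clin_scaleC[OF assms, symmetric])
qed

lemma csubspace_closure:
  assumes "csubspace S"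
  shows "csubspace (closure S)"
proof (rule csubspaceI)
  show "0 \<in> closure S"
    using assms closure_subset[of S] by (auto simp: csubspace_def subspace_0)
  show "x + y \<in> closure S" if x: "x \<in> closure S" and y: "y \<in> closure S" for x y
  proof -
    obtain f where f: "\<And>n. f n \<in> S" "f \<longlonglongrightarrow> x"
      using x by (auto simp: closure_sequential)
    obtain g where g: "\<And>n. g n \<in> S" "g \<longlonglongrightarrow> y"
      using y by (auto simp: closure_sequential)
    have "f n + g n \<in> S" for n
      using f g assms by (simp add: csubspace_def subspace_add)
    then show ?thesis
      using tendsto_add[OF f(2) g(2)]
      by (intro closure_sequential[THEN iffD2] exI[of _ "\<lambda>n. f n + g n"]) simp
  qed
  show "scaleC c x \<in> closure S" if x: "x \<in> closure S" for c x
  proof -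
    obtain f where f: "\<And>n. f n \<in> S" "f \<longlonglongrightarrow> x"
      using x by (auto simp: closure_sequential)
    have "scaleC c (f n) \<in> S" for n
      using f assms by (simp add: csubspace_def)
    then show ?thesis
      using tendsto_scaleC[OF f(2)]
      by (intro closure_sequential[THEN iffD2] exI[of _ "\<lambda>n. scaleC c (f n)"]) simp
  qed
qed

text \<open>The imaginary part of \<open>cinner x y\<close> is the real inner product of
  \<open>x\<close> with \<open>scaleC \<i> y\<close>, which again lies in \<open>S\<close>; hence
  real and complex orthogonality to \<open>S\<close> agree.\<close>

lemma mem_orth_iff:
  assumes "csubspace S"
  shows "x \<in> orth S \<longleftrightarrow> (\<forall>y\<in>S. inner x y = 0)"
  using assms unfolding orth_def csubspace_def by (auto simp: cinner_eq_Complex complex_eq_iff)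

lemma csubspace_orth: "csubspace (orth S)"
proof (rule csubspaceI)
  show "0 \<in> orth S"
    using cinner_add_left[of 0 0] by (auto simp: orth_def)
qed (auto simp: orth_def cinner_add_left cinner_scaleC_left)

lemma closed_orth: "closed (orth S)"
proof -
  have "orth S = (\<Inter>y\<in>S. {x. inner x y = 0} \<inter> {x. inner x (scaleC \<i> y) = 0})"
    by (auto simp: orth_def cinner_eq_Complex complex_eq_iff)
  moreover have "closed ({x. inner x y = 0} \<inter> {x. inner x (scaleC \<i> y) = 0})" for y :: 'a
    by (intro closed_Int closed_Collect_eq continuous_intros)
  ultimately show ?thesis
    by auto
qed

lemma orth_diff: "x \<in> orth S \<Longrightarrow> y \<in> orth S \<Longrightarrow> x - y \<in> orth S"
  by (rule subspace_diff[OF csubspace_subspace[OF csubspace_orth]])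

lemma orth_inner: "x \<in> orth S \<Longrightarrow> y \<in> S \<Longrightarrow> inner x y = 0"
  by (simp add: orth_def inner_eq_Re_cinner)

lemma inner_orth: "x \<in> S \<Longrightarrow> y \<in> orth S \<Longrightarrow> inner x y = 0"
  using orth_inner inner_commute by metis

lemma orth_zero: "0 \<in> orth S"
  by (rule subspace_0[OF csubspace_subspace[OF csubspace_orth]])

lemma orth_self: "x \<in> S \<Longrightarrow> x \<in> orth S \<Longrightarrow> x = 0"
  using orth_inner[of x S x] by simp

lemma orth_antimono: "S \<subseteq> V \<Longrightarrow> orth V \<subseteq> orth S"
  by (auto simp: orth_def)

lemma orth_closure: "orth (closure S) = orth S"
proof
  show "orth (closure S) \<subseteq> orth S"
    using closure_subset by (rule orth_antimono)
  have "closure S \<subseteq> orth (orth S)"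
  proof (rule closure_minimal[OF _ closed_orth])
    show "S \<subseteq> orth (orth S)"
      unfolding orth_def by (auto) (metis cinner_commute complex_cnj_zero)
  qed
  then show "orth S \<subseteq> orth (closure S)"
    unfolding orth_def by (auto simp: subset_iff) (metis cinner_commute complex_cnj_zero)
qed

text \<open>The closest point of \<open>S\<close> to \<open>x\<close> is the limit of a minimizing
  sequence, which is Cauchy because midpoints stay in \<open>S\<close> (parallelogram law). The real
  setting lets the lemma serve kernels of real functionals as well.\<close>

lemma subspace_projection_exists:
  fixes S :: "'a::{real_inner,banach} set"
  assumes "closed S" "subspace S"
  shows "\<exists>p\<in>S. \<forall>y\<in>S. inner (x - p) y = 0"
proof -
  define F where "F = (\<lambda>y. (norm (x - y))\<^sup>2) ` S"
  define D where "D = Inf F"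
  have S0: "0 \<in> S"
    using assms(2) by (rule subspace_0)
  have bdd: "bdd_below F"
    unfolding F_def by (rule bdd_belowI[of _ 0]) auto
  have lower: "D \<le> (norm (x - y))\<^sup>2" if "y \<in> S" for y
    unfolding D_def by (rule cInf_lower[OF _ bdd]) (use that in \<open>auto simp: F_def\<close>)
  have "\<exists>y\<in>S. (norm (x - y))\<^sup>2 < D + 1 / real (Suc n)" for n
  proof -
    have "Inf F < D + 1 / real (Suc n)"
      by (simp add: D_def)
    then show ?thesis
      using cInf_lessD[of F] S0 by (auto simp: F_def)
  qed
  then obtain f where fS: "\<And>n. f n \<in> S" and f: "\<And>n. (norm (x - f n))\<^sup>2 < D + 1 / real (Suc n)"
    by metis
  have parallelogram: "(norm (f m - f n))\<^sup>2 \<le> 2 / real (Suc m) + 2 / real (Suc n)" for m n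
  proof -
    let ?z = "(1/2) *\<^sub>R (f m + f n)"
    have "?z \<in> S"
      by (intro subspace_mul subspace_add assms fS)
    then have "D \<le> (norm (x - ?z))\<^sup>2"
      by (rule lower)
    moreover have "(norm (f m - f n))\<^sup>2
        = 2 * (norm (x - f m))\<^sup>2 + 2 * (norm (x - f n))\<^sup>2 - 4 * (norm (x - ?z))\<^sup>2"
      by (simp add: power2_norm_eq_inner inner_diff_left inner_diff_right inner_add_left
          inner_add_right inner_commute algebra_simps)
    ultimately show ?thesis
      using f[of m] f[of n] by simp
  qed
  have "Cauchy f"
  proof (rule CauchyI)
    fix e :: real assume e: "0 < e"
    obtain N where "4 / e\<^sup>2 < real N"
      using reals_Archimedean2 by blast
    then have "4 < real N * e\<^sup>2"
      using e by (simp add: field_simps)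
    moreover have "real (Suc N) * e\<^sup>2 = e\<^sup>2 + real N * e\<^sup>2" "0 < e\<^sup>2"
      using e by (simp_all add: distrib_right)
    ultimately have "4 < real (Suc N) * e\<^sup>2"
      by linarith
    then have N: "4 / real (Suc N) < e\<^sup>2"
      by (simp add: pos_divide_less_eq mult.commute del: of_nat_Suc)
    have "norm (f m - f n) < e" if "m \<ge> N" "n \<ge> N" for m n
    proof -
      have "2 / real (Suc m) \<le> 2 / real (Suc N)" "2 / real (Suc n) \<le> 2 / real (Suc N)"
        using that by (auto intro!: divide_left_mono)
      then have "(norm (f m - f n))\<^sup>2 < e\<^sup>2"
        using parallelogram[of m n] N by linarith
      then show ?thesis
        using e by (simp add: power_less_imp_less_base)
    qed
    then show "\<exists>M. \<forall>m\<ge>M. \<forall>n\<ge>M. norm (f m - f n) < e"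
      by blast
  qed
  then obtain p where p: "f \<longlonglongrightarrow> p"
    using Cauchy_convergent convergent_def by blast
  have pS: "p \<in> S"
    using assms(1) fS p by (rule closed_sequentially)
  have "(norm (x - p))\<^sup>2 \<le> D"
  proof (rule LIMSEQ_le)
    show "(\<lambda>n. (norm (x - f n))\<^sup>2) \<longlonglongrightarrow> (norm (x - p))\<^sup>2"
      by (intro tendsto_intros p)
    show "(\<lambda>n. D + 1 / real (Suc n)) \<longlonglongrightarrow> D"
      using tendsto_add[OF tendsto_const[of D] LIMSEQ_inverse_real_of_nat]
      by (simp add: inverse_eq_divide)
  qed (use f less_imp_le in blast)
  have "inner (x - p) y = 0" if "y \<in> S" for y
  proof (cases "y = 0")
    case False
    \<comment> \<open>This \<open>t\<close> minimizes the quadratic polynomial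
      \<open>(norm (x - (p + t *\<^sub>R y)))\<^sup>2\<close>; a nonzero inner product would push
      its value below the minimum.\<close>
    define t where "t = inner (x - p) y / inner y y"
    have "p + t *\<^sub>R y \<in> S"
      by (intro subspace_mul subspace_add assms pS that)
    then have "(norm (x - p))\<^sup>2 \<le> (norm (x - (p + t *\<^sub>R y)))\<^sup>2"
      using lower \<open>(norm (x - p))\<^sup>2 \<le> D\<close> order_trans by blast
    also have "\<dots> = (norm (x - p))\<^sup>2 - 2 * t * inner (x - p) y + t * t * inner y y"
      by (simp add: power2_norm_eq_inner inner_diff_left inner_diff_right inner_add_left
          inner_add_right inner_commute algebra_simps)
    also have "\<dots> = (norm (x - p))\<^sup>2 - (inner (x - p) y)\<^sup>2 / inner y y"
      using False by (simp add: t_def power2_eq_square)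
    finally have "(inner (x - p) y)\<^sup>2 / inner y y \<le> 0"
      by simp
    moreover have "0 < inner y y"
      using False by simp
    ultimately show ?thesis
      by (simp add: divide_le_0_iff)
  qed simp
  with pS show ?thesis
    by blast
qed

lemma
  assumes "closed S" "csubspace S"
  shows orth_proj_mem: "orth_proj S x \<in> S"
    and orth_proj_diff: "x - orth_proj S x \<in> orth S"
    and orth_proj_unique: "p \<in> S \<Longrightarrow> x - p \<in> orth S \<Longrightarrow> orth_proj S x = p"
proof -
  have ex: "\<exists>p. p \<in> S \<and> x - p \<in> orth S"
    using subspace_projection_exists[of S x] assms
    by (auto simp: mem_orth_iff csubspace_subspace)
  have uniq: "p = q" if "p \<in> S" "x - p \<in> orth S" "q \<in> S" "x - q \<in> orth S" for p q
  proof -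
    have "p - q \<in> S"
      using that assms by (simp add: csubspace_def subspace_diff)
    moreover have "p - q \<in> orth S"
      using orth_diff[OF that(4) that(2)] by simp
    ultimately show ?thesis
      using orth_self by fastforce
  qed
  have "\<exists>!p. p \<in> S \<and> x - p \<in> orth S"
    using ex uniq by blast
  from theI'[OF this] show "orth_proj S x \<in> S" "x - orth_proj S x \<in> orth S"
    unfolding orth_proj_def by auto
  then show "orth_proj S x = p" if "p \<in> S" "x - p \<in> orth S"
    using that uniq by blast
qed

lemma orth_proj_id: "closed S \<Longrightarrow> csubspace S \<Longrightarrow> x \<in> S \<Longrightarrow> orth_proj S x = x"
  by (rule orth_proj_unique) (auto simp: orth_zero)

lemma orth_proj_zero: "closed S \<Longrightarrow> csubspace S \<Longrightarrow> x \<in> orth S \<Longrightarrow> orth_proj S x = 0"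
  by (rule orth_proj_unique) (auto simp: csubspace_def subspace_0)

lemma orth_proj_pythagoras:
  assumes "closed S" "csubspace S"
  shows "(norm x)\<^sup>2 = (norm (orth_proj S x))\<^sup>2 + (norm (x - orth_proj S x))\<^sup>2"
proof -
  have "inner (x - orth_proj S x) (orth_proj S x) = 0"
    using orth_proj_diff[OF assms] orth_proj_mem[OF assms] by (rule orth_inner)
  then show ?thesis
    by (simp add: power2_norm_eq_inner inner_diff_left inner_diff_right inner_commute)
qed

lemma norm_orth_proj_le:
  assumes "closed S" "csubspace S"
  shows "norm (orth_proj S x) \<le> norm x"
  using orth_proj_pythagoras[OF assms, of x] by (simp add: power2_le_imp_le)

lemma bounded_clinear_orth_proj:
  assumes "closed S" "csubspace S"
  shows "bounded_clinear (orth_proj S)"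
proof (rule bounded_clinearI[of _ 1])
  note S = orth_proj_mem[OF assms] and orthS = orth_proj_diff[OF assms]
  show "orth_proj S (x + y) = orth_proj S x + orth_proj S y" for x y
  proof (rule orth_proj_unique[OF assms])
    show "orth_proj S x + orth_proj S y \<in> S"
      using S assms by (simp add: csubspace_def subspace_add)
    have "(x - orth_proj S x) + (y - orth_proj S y) \<in> orth S"
      using orthS csubspace_orth[of S] by (simp add: csubspace_def subspace_add)
    then show "x + y - (orth_proj S x + orth_proj S y) \<in> orth S"
      by (simp add: algebra_simps)
  qed
  show "orth_proj S (scaleC c x) = scaleC c (orth_proj S x)" for c x
  proof (rule orth_proj_unique[OF assms])
    show "scaleC c (orth_proj S x) \<in> S"
      using S assms by (simp add: csubspace_def)
    show "scaleC c x - scaleC c (orth_proj S x) \<in> orth S"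
      using orthS csubspace_orth[of S] by (simp add: csubspace_def scaleC_diff_right[symmetric])
  qed
  show "norm (orth_proj S x) \<le> 1 * norm x" for x
    using norm_orth_proj_le[OF assms] by simp
qed

lemma orth_orth:
  assumes "closed S" "csubspace S"
  shows "orth (orth S) = S"
proof
  show "orth (orth S) \<subseteq> S"
  proof
    fix x assume x: "x \<in> orth (orth S)"
    have "orth_proj S x \<in> orth (orth S)"
      using orth_proj_mem[OF assms, of x] mem_orth_iff[OF csubspace_orth[of S]]
      by (auto simp: inner_orth)
    then have "x - orth_proj S x = 0"
      using orth_diff[OF x] orth_proj_diff[OF assms] orth_self by blast
    then show "x \<in> S"
      using orth_proj_mem[OF assms, of x] by simp
  qed
  show "S \<subseteq> orth (orth S)"
    using mem_orth_iff[OF csubspace_orth[of S]] by (auto simp: inner_orth)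
qed

lemma orth_proj_orth:
  assumes "closed S" "csubspace S"
  shows "orth_proj (orth S) x = x - orth_proj S x"
  by (rule orth_proj_unique[OF closed_orth csubspace_orth])
    (use assms in \<open>auto simp: orth_orth orth_proj_mem orth_proj_diff\<close>)

section \<open>Adjoints\<close>

text \<open>The component \<open>w\<close> of some \<open>x0\<close> orthogonal to the kernel spans
  its complement: subtracting \<open>(f x / f w) *\<^sub>R w\<close> from \<open>x\<close> lands in
  the kernel.\<close>

lemma riesz_representation:
  fixes f :: "'a::{real_inner,banach} \<Rightarrow> real"
  assumes "bounded_linear f"
  shows "\<exists>z. \<forall>x. f x = inner x z"
proof (cases "\<forall>x. f x = 0")
  case True
  then show ?thesis
    by (intro exI[of _ 0]) simp
next
  case False
  then obtain x0 where x0: "f x0 \<noteq> 0"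
    by blast
  interpret f: bounded_linear f
    by fact
  let ?S = "{x. f x = 0}"
  have "closed ?S"
    by (intro closed_Collect_eq continuous_intros f.continuous_on)
  moreover have "subspace ?S"
    by (auto simp: subspace_def f.add f.scaleR f.zero)
  ultimately obtain p where p: "f p = 0" "\<And>y. f y = 0 \<Longrightarrow> inner (x0 - p) y = 0"
    using subspace_projection_exists[of ?S x0] by blast
  define w where "w = x0 - p"
  have fw: "f w \<noteq> 0"
    using x0 p by (simp add: w_def f.diff)
  then have w: "inner w w \<noteq> 0"
    using f.zero by auto
  have "f x = inner x ((f w / inner w w) *\<^sub>R w)" for x
  proof -
    have "f (x - (f x / f w) *\<^sub>R w) = 0"
      using fw by (simp add: f.diff f.scaleR)
    then have "inner w (x - (f x / f w) *\<^sub>R w) = 0"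
      using p(2) by (simp add: w_def)
    then have "inner w x = (f x / f w) * inner w w"
      by (simp add: inner_diff_right)
    then show ?thesis
      using fw w by (simp add: inner_commute)
  qed
  then show ?thesis
    by blast
qed

lemma inner_left_eqI: "(\<And>x. inner x y = inner x z) \<Longrightarrow> y = (z::'a::real_inner)"
  using inner_diff_right[of "y - z" y z] by simp

text \<open>Riesz gives the adjoint relation for the real form; applying it to
  \<open>scaleC \<i> x\<close> recovers the imaginary part. The resulting map is thus the unique one
  described by \<open>adj\<close>.\<close>

lemma inner_adj:
  assumes "bounded_clinear T"
  shows "inner (T x) y = inner x (adj T y)"
proof -
  have "\<exists>z. \<forall>x. inner (T x) y = inner x z" for y
    by (rule riesz_representation)
      (rule bounded_linear_inner_left_comp[OF bounded_clinear_bounded_linear[OF assms]])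
  then obtain R where R: "\<And>x y. inner (T x) y = inner x (R y)"
    by metis
  have "inner (T x) (scaleC \<i> y) = inner x (scaleC \<i> (R y))" for x y
    using R[of "scaleC \<i> x" y] by (simp add: clin_scaleC[OF assms] inner_scaleC_i_left)
  then have "\<forall>x y. cinner (T x) y = cinner x (R y)"
    by (simp add: cinner_eq_Complex R)
  moreover have "R' = R" if "\<forall>x y. cinner (T x) y = cinner x (R' y)" for R'
  proof
    show "R' y = R y" for y
    proof (rule inner_left_eqI)
      fix x
      have "cinner x (R' y) = cinner (T x) y"
        using that by simp
      then show "inner x (R' y) = inner x (R y)"
        using R[of x y] by (simp add: inner_eq_Re_cinner)
    qed
  qed
  ultimately have "adj T = R"
    unfolding adj_def by (intro the_equality) blast+
  then show ?thesis
    by (simp add: R)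
qed

lemma inner_adj_left:
  assumes "bounded_clinear T"
  shows "inner (adj T y) x = inner y (T x)"
  using inner_adj[OF assms] by (metis inner_commute)

lemma adj_eqI:
  assumes "bounded_clinear T" "\<And>x y. inner (T x) y = inner x (R y)"
  shows "adj T = R"
proof
  show "adj T y = R y" for y
    by (rule inner_left_eqI) (simp add: assms(2)[symmetric] inner_adj[OF assms(1), symmetric])
qed

lemma bounded_clinear_adj:
  assumes "bounded_clinear T"
  shows "bounded_clinear (adj T)"
proof -
  obtain K where K: "K > 0" "\<And>x. norm (T x) \<le> K * norm x"
    using clin_bound[OF assms] by blast
  show ?thesis
  proof (rule bounded_clinearI[of _ K])
    show "adj T (x + y) = adj T x + adj T y" for x y
      by (rule inner_left_eqI) (simp add: inner_adj[OF assms, symmetric] inner_add_right)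
    have i: "adj T (scaleC \<i> x) = scaleC \<i> (adj T x)" for x
    proof (rule inner_left_eqI)
      fix z
      have "inner z (adj T (scaleC \<i> x)) = - inner (T (scaleC \<i> z)) x"
        by (simp add: inner_adj[OF assms, symmetric] clin_scaleC[OF assms] inner_scaleC_i_left)
      then show "inner z (adj T (scaleC \<i> x)) = inner z (scaleC \<i> (adj T x))"
        by (simp add: inner_adj[OF assms] inner_scaleC_i_left)
    qed
    show "adj T (scaleC c x) = scaleC c (adj T x)" for c x
    proof (rule inner_left_eqI)
      fix z
      show "inner z (adj T (scaleC c x)) = inner z (scaleC c (adj T x))"
        by (simp add: inner_adj[OF assms, symmetric] scaleC_conv_scaleR[of c] inner_add_right i[symmetric])
    qed
    show "norm (adj T y) \<le> K * norm y" for y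
    proof -
      have "norm (adj T y) * norm (adj T y) = inner (T (adj T y)) y"
        by (simp add: inner_adj[OF assms] power2_norm_eq_inner[symmetric] power2_eq_square)
      also have "\<dots> \<le> norm (T (adj T y)) * norm y"
        by (rule norm_cauchy_schwarz)
      also have "\<dots> \<le> K * norm (adj T y) * norm y"
        by (intro mult_right_mono K) simp
      finally show ?thesis
        using K(1) by (cases "adj T y = 0") (auto simp: mult.commute mult.left_commute)
    qed
  qed
qed

lemma adj_adj: "bounded_clinear T \<Longrightarrow> adj (adj T) = T"
  by (rule adj_eqI) (simp_all add: bounded_clinear_adj inner_adj_left)

lemma adj_compose:
  assumes "bounded_clinear S" "bounded_clinear T"
  shows "adj (S \<circ> T) = adj T \<circ> adj S"
  by (rule adj_eqI) (simp_all add: assms bounded_clinear_compose inner_adj[OF assms(1)] inner_adj[OF assms(2)])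

lemma orth_range:
  assumes "bounded_clinear T"
  shows "orth (range T) = nullspace (adj T)"
proof -
  have "x \<in> orth (range T) \<longleftrightarrow> adj T x = 0" for x
  proof -
    have "x \<in> orth (range T) \<longleftrightarrow> (\<forall>y. inner (adj T x) y = 0)"
      by (simp add: mem_orth_iff[OF csubspace_range[OF assms]] inner_adj_left[OF assms])
    also have "\<dots> \<longleftrightarrow> adj T x = 0"
      by (metis inner_eq_zero_iff inner_zero_left)
    finally show ?thesis .
  qed
  then show ?thesis
    by (auto simp: nullspace_def)
qed

text \<open>The nullspace is itself the complement of \<open>range (adj T)\<close>, and the double
  complement of a subspace is its closure.\<close>

lemma orth_nullspace:
  assumes "bounded_clinear T"
  shows "orth (nullspace T) = closure (range (adj T))"
proof -
  have T': "bounded_clinear (adj T)"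
    using assms by (rule bounded_clinear_adj)
  have "nullspace T = orth (range (adj T))"
    using orth_range[OF T'] adj_adj[OF assms] by simp
  then show ?thesis
    using orth_orth[OF closed_closure csubspace_closure[OF csubspace_range[OF T']]]
    by (simp add: orth_closure)
qed

section \<open>Factorization of operators\<close>

lemma closure_range_sequential:
  fixes F :: "'a \<Rightarrow> 'b::metric_space"
  assumes "y \<in> closure (range F)"
  shows "\<exists>w. (\<lambda>n. F (w n)) \<longlonglongrightarrow> y"
proof -
  obtain v where v: "\<And>n::nat. v n \<in> range F" "v \<longlonglongrightarrow> y"
    using assms by (auto simp: closure_sequential)
  have "F (inv F (v n)) = v n" for n
    using v(1) by (simp add: f_inv_into_f)
  with v(2) show ?thesis
    by (intro exI[of _ "\<lambda>n. inv F (v n)"]) simp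
qed

text \<open>The bound makes \<open>F w \<mapsto> G w\<close> well defined and continuous on the
  range of \<open>F\<close>; it extends to the closure by limits and by zero to the complement. Both
  Douglas' lemma and the polar decomposition rest on this.\<close>

lemma factor_through_extension:
  fixes F :: "'a::chilbert_space \<Rightarrow> 'b::chilbert_space" and G :: "'a \<Rightarrow> 'c::chilbert_space"
  assumes F: "bounded_clinear F" and G: "bounded_clinear G"
    and le: "\<And>w. norm (G w) \<le> C * norm (F w)"
  shows "\<exists>Z. bounded_clinear Z \<and> Z \<circ> F = G \<and> (\<forall>x\<in>orth (range F). Z x = 0)"
proof -
  let ?M = "closure (range F)"
  have M: "closed ?M" "csubspace ?M"
    by (auto intro: csubspace_closure csubspace_range F)
  let ?P = "orth_proj ?M"
  have P: "bounded_clinear ?P"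
    using M by (rule bounded_clinear_orth_proj)
  \<comment> \<open>\<open>C\<close> may be nonpositive; a positive bound can be divided by in the
    Cauchy estimate.\<close>
  define K where "K = max C 1"
  have K: "K > 0"
    by (simp add: K_def)
  have leK: "norm (G w) \<le> K * norm (F w)" for w
    using le[of w] mult_right_mono[of C K "norm (F w)"] by (simp add: K_def)
  have approx: "\<exists>w. (\<lambda>n. F (w n)) \<longlonglongrightarrow> ?P x" for x
    using orth_proj_mem[OF M] by (rule closure_range_sequential)
  have "\<exists>z. \<forall>w. (\<lambda>n. F (w n)) \<longlonglongrightarrow> ?P x \<longrightarrow> (\<lambda>n. G (w n)) \<longlonglongrightarrow> z" for x
  proof -
    obtain w0 where w0: "(\<lambda>n. F (w0 n)) \<longlonglongrightarrow> ?P x"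
      using approx by blast
    have "Cauchy (\<lambda>n. G (w0 n))"
    proof (rule CauchyI)
      fix e :: real assume e: "0 < e"
      have "Cauchy (\<lambda>n. F (w0 n))"
        using w0 convergentI convergent_Cauchy by blast
      then obtain N where N: "\<And>m n. m \<ge> N \<Longrightarrow> n \<ge> N \<Longrightarrow> norm (F (w0 m) - F (w0 n)) < e / K"
        using CauchyD[of _ "e / K"] e K by (metis divide_pos_pos)
      have "norm (G (w0 m) - G (w0 n)) < e" if "m \<ge> N" "n \<ge> N" for m n
      proof -
        have "norm (G (w0 m) - G (w0 n)) \<le> K * norm (F (w0 m) - F (w0 n))"
          using leK[of "w0 m - w0 n"] by (simp add: clin_diff[OF F] clin_diff[OF G])
        also have "\<dots> < e"
          using N[OF that] K by (simp add: pos_less_divide_eq mult.commute)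
        finally show ?thesis .
      qed
      then show "\<exists>M. \<forall>m\<ge>M. \<forall>n\<ge>M. norm (G (w0 m) - G (w0 n)) < e"
        by blast
    qed
    then obtain z where z: "(\<lambda>n. G (w0 n)) \<longlonglongrightarrow> z"
      using Cauchy_convergent convergent_def by blast
    \<comment> \<open>The limit does not depend on the approximating sequence, so it defines
      \<open>Z x\<close>.\<close>
    have "(\<lambda>n. G (w n)) \<longlonglongrightarrow> z" if w: "(\<lambda>n. F (w n)) \<longlonglongrightarrow> ?P x" for w
    proof -
      have "(\<lambda>n. K * norm (F (w n) - F (w0 n))) \<longlonglongrightarrow> K * norm (?P x - ?P x)"
        by (intro tendsto_intros w w0)
      then have "(\<lambda>n. K * norm (F (w n) - F (w0 n))) \<longlonglongrightarrow> 0"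
        by simp
      moreover have "\<forall>n. norm (G (w n) - G (w0 n)) \<le> K * norm (F (w n) - F (w0 n))"
      proof
        show "norm (G (w n) - G (w0 n)) \<le> K * norm (F (w n) - F (w0 n))" for n
          using leK[of "w n - w0 n"] by (simp add: clin_diff[OF F] clin_diff[OF G])
      qed
      ultimately have "(\<lambda>n. G (w n) - G (w0 n)) \<longlonglongrightarrow> 0"
        by (rule Lim_null_comparison[OF always_eventually, rotated])
      from tendsto_add[OF this z] show ?thesis
        by simp
    qed
    then show ?thesis
      by blast
  qed
  then obtain Z where Z: "\<And>x w. (\<lambda>n. F (w n)) \<longlonglongrightarrow> ?P x \<Longrightarrow> (\<lambda>n. G (w n)) \<longlonglongrightarrow> Z x"
    by metis
  have "bounded_clinear Z"
  proof (rule bounded_clinearI[of _ K])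
    fix x
    obtain w where w: "(\<lambda>n. F (w n)) \<longlonglongrightarrow> ?P x"
      using approx by blast
    show "Z (x + y) = Z x + Z y" for y
    proof -
      obtain w' where w': "(\<lambda>n. F (w' n)) \<longlonglongrightarrow> ?P y"
        using approx by blast
      have "(\<lambda>n. F (w n + w' n)) \<longlonglongrightarrow> ?P (x + y)"
        using tendsto_add[OF w w'] by (simp add: clin_add[OF F] clin_add[OF P])
      from Z[OF this] have "(\<lambda>n. G (w n) + G (w' n)) \<longlonglongrightarrow> Z (x + y)"
        by (simp add: clin_add[OF G])
      then show ?thesis
        using tendsto_add[OF Z[OF w] Z[OF w']] by (rule LIMSEQ_unique)
    qed
    show "Z (scaleC c x) = scaleC c (Z x)" for c
    proof -
      have "(\<lambda>n. F (scaleC c (w n))) \<longlonglongrightarrow> ?P (scaleC c x)"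
        using tendsto_scaleC[OF w] by (simp add: clin_scaleC[OF F] clin_scaleC[OF P])
      from Z[OF this] have "(\<lambda>n. scaleC c (G (w n))) \<longlonglongrightarrow> Z (scaleC c x)"
        by (simp add: clin_scaleC[OF G])
      then show ?thesis
        using tendsto_scaleC[OF Z[OF w]] by (rule LIMSEQ_unique)
    qed
    have "norm (Z x) \<le> K * norm (?P x)"
    proof (rule LIMSEQ_le)
      show "(\<lambda>n. norm (G (w n))) \<longlonglongrightarrow> norm (Z x)"
        by (rule tendsto_norm[OF Z[OF w]])
      show "(\<lambda>n. K * norm (F (w n))) \<longlonglongrightarrow> K * norm (?P x)"
        by (rule tendsto_mult_left[OF tendsto_norm[OF w]])
    qed (use leK in blast)
    also have "\<dots> \<le> K * norm x"
      using K norm_orth_proj_le[OF M] by (simp add: mult_left_mono)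
    finally show "norm (Z x) \<le> K * norm x" .
  qed
  moreover have "Z \<circ> F = G"
  proof
    fix w
    have "?P (F w) = F w"
      using M closure_subset[of "range F"] by (intro orth_proj_id) auto
    then have "(\<lambda>n. G w) \<longlonglongrightarrow> Z (F w)"
      using Z[of "\<lambda>n. w" "F w"] by simp
    then show "(Z \<circ> F) w = G w"
      by (simp add: LIMSEQ_const_iff)
  qed
  moreover have "Z x = 0" if "x \<in> orth (range F)" for x
  proof -
    have "?P x = 0"
      using that by (intro orth_proj_zero M) (simp add: orth_closure)
    then have "(\<lambda>n. G 0) \<longlonglongrightarrow> Z x"
      using Z[of "\<lambda>n. 0" x] by (simp add: clin_zero[OF F])
    then show ?thesis
      by (simp add: LIMSEQ_const_iff clin_zero[OF G])
  qed
  ultimately show ?thesis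
    by blast
qed

text \<open>Uniform boundedness by Baire category: the closed sets \<open>X n\<close> cover the
  space, so one contains a ball, and comparing its centre with a shift in the direction of
  \<open>w\<close> bounds \<open>norm w\<close>.\<close>

lemma weakly_bounded_imp_bounded:
  fixes W :: "'a::{real_inner,banach} set"
  assumes weak: "\<And>x. \<exists>C. \<forall>w\<in>W. \<bar>inner x w\<bar> \<le> C"
  shows "\<exists>C. \<forall>w\<in>W. norm w \<le> C"
proof -
  define X where "X n = {x. \<forall>w\<in>W. \<bar>inner x w\<bar> \<le> real n}" for n :: nat
  have closed: "closed (X n)" for n
  proof -
    have "X n = (\<Inter>w\<in>W. {x. \<bar>inner x w\<bar> \<le> real n})"
      by (auto simp: X_def)
    moreover have "closed {x. \<bar>inner x w\<bar> \<le> real n}" for w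
      by (intro closed_Collect_le continuous_intros)
    ultimately show ?thesis
      by auto
  qed
  have "x \<in> (\<Union>n. X n)" for x
  proof -
    obtain C where C: "\<forall>w\<in>W. \<bar>inner x w\<bar> \<le> C"
      using weak by blast
    obtain n where "C \<le> real n"
      using real_arch_simple by blast
    with C have "x \<in> X n"
      by (force simp: X_def)
    then show ?thesis
      by blast
  qed
  then have "\<Union>(range X) = UNIV"
    by blast
  then have "euclidean interior_of \<Union>(range X) \<noteq> {}"
    by simp
  then obtain n where "interior (X n) \<noteq> {}"
    using Baire_category_alt[of euclidean "range X"] closed
      completely_metrizable_space_euclidean
    by force
  then obtain x0 where "x0 \<in> interior (X n)"
    by blast
  then obtain r where r: "r > 0" "ball x0 r \<subseteq> X n"
    by (auto simp: mem_interior)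
  have "norm w \<le> 4 * real n / r" if "w \<in> W" for w
  proof (cases "w = 0")
    case False
    define t where "t = r / (2 * norm w)"
    have t: "t > 0"
      using r False by (simp add: t_def)
    have "norm (t *\<^sub>R w) < r"
      using r False by (simp add: t_def)
    then have "x0 + t *\<^sub>R w \<in> ball x0 r"
      by (simp add: dist_norm)
    with r have "x0 + t *\<^sub>R w \<in> X n" "x0 \<in> X n"
      by auto
    then have "\<bar>inner (x0 + t *\<^sub>R w) w\<bar> \<le> real n" "\<bar>inner x0 w\<bar> \<le> real n"
      using that by (auto simp: X_def)
    then have "t * inner w w \<le> 2 * real n"
      by (simp add: inner_add_left)
    moreover have "t * inner w w = r / 2 * norm w"
      using False by (simp add: t_def power2_norm_eq_inner[symmetric] power2_eq_square)
    ultimately show ?thesis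
      using r by (simp add: field_simps)
  qed (use r in simp)
  then show ?thesis
    by blast
qed

text \<open>The range inclusion makes the adjoints \<open>D\<^sup>* w\<close> with \<open>\<parallel>E\<^sup>* w\<parallel> \<le> 1\<close> weakly bounded, hence
  bounded, so that \<open>E\<^sup>* w \<mapsto> D\<^sup>* w\<close> extends to a bounded operator, the adjoint of the factor sought.\<close>

theorem douglas_factorization:
  fixes D :: "'a::chilbert_space \<Rightarrow> 'c::chilbert_space" and E :: "'b::chilbert_space \<Rightarrow> 'c"
  assumes D: "bounded_clinear D" and E: "bounded_clinear E" and sub: "range D \<subseteq> range E"
  shows "\<exists>X. bounded_clinear X \<and> D = E \<circ> X"
proof -
  note D' = bounded_clinear_adj[OF D] and E' = bounded_clinear_adj[OF E]
  define W where "W = adj D ` {w. norm (adj E w) \<le> 1}"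
  have "\<exists>C. \<forall>v\<in>W. \<bar>inner x v\<bar> \<le> C" for x
  proof -
    obtain y where y: "D x = E y"
      using sub by blast
    have "\<bar>inner x (adj D w)\<bar> \<le> norm y" if "norm (adj E w) \<le> 1" for w
    proof -
      have "inner x (adj D w) = inner y (adj E w)"
        by (simp add: inner_adj[OF D, symmetric] inner_adj[OF E, symmetric] y)
      also have "\<bar>\<dots>\<bar> \<le> norm y * norm (adj E w)"
        by (rule Cauchy_Schwarz_ineq2)
      also have "\<dots> \<le> norm y"
        using that by (simp add: mult_left_le)
      finally show ?thesis .
    qed
    then show ?thesis
      by (auto simp: W_def)
  qed
  then obtain C where C: "\<And>w. norm (adj E w) \<le> 1 \<Longrightarrow> norm (adj D w) \<le> C"
    using weakly_bounded_imp_bounded[of W] by (auto simp: W_def)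
  \<comment> \<open>By homogeneity the bound on the unit ball holds for every rescaling of
    \<open>w\<close> into that ball.\<close>
  have scaled: "t * norm (adj D w) \<le> C" if "t > 0" "t * norm (adj E w) \<le> 1" for t w
    using C[of "scaleC (of_real t) w"] that
    by (simp add: clin_scaleC[OF D'] clin_scaleC[OF E'] norm_scaleC)
  have "norm (adj D w) \<le> C * norm (adj E w)" for w
  proof (cases "adj E w = 0")
    case True
    have "norm (adj D w) = 0"
    proof (rule ccontr)
      assume "norm (adj D w) \<noteq> 0"
      then have pos: "norm (adj D w) > 0"
        by simp
      \<comment> \<open>When \<open>adj E w = 0\<close> every positive factor is admissible; this
        one would give \<open>\<bar>C\<bar> + 1 \<le> C\<close>.\<close>
      have "(\<bar>C\<bar> + 1) / norm (adj D w) * norm (adj D w) \<le> C"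
        by (rule scaled) (use pos True in auto)
      then show False
        using pos by simp
    qed
    then show ?thesis
      using True by simp
  next
    case False
    then have "1 / norm (adj E w) * norm (adj D w) \<le> C"
      by (intro scaled) auto
    then show ?thesis
      using False by (simp add: divide_le_eq)
  qed
  then obtain Z where Z: "bounded_clinear Z" "Z \<circ> adj E = adj D"
    using factor_through_extension[OF E' D'] by blast
  have "D = adj (Z \<circ> adj E)"
    using Z(2) adj_adj[OF D] by simp
  also have "\<dots> = E \<circ> adj Z"
    using adj_compose[OF Z(1) E'] adj_adj[OF E] by simp
  finally show ?thesis
    using bounded_clinear_adj[OF Z(1)] by blast
qed

section \<open>Positive operators and their square roots\<close>

lemma positive_op_clinear: "positive_op T \<Longrightarrow> bounded_clinear T"
  by (simp add: positive_op_def)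

lemma positive_op_nonneg: "positive_op T \<Longrightarrow> 0 \<le> inner (T x) x"
  by (simp add: positive_op_def inner_eq_Re_cinner)

text \<open>Polarization: the quadratic form is real at \<open>x\<close>, \<open>z\<close> and
  \<open>x + z\<close>, so the imaginary parts of the cross terms cancel;
  \<open>z = scaleC \<i> y\<close> turns this into symmetry.\<close>

lemma positive_op_sym:
  assumes "positive_op T"
  shows "inner (T x) y = inner x (T y)"
proof -
  have T: "bounded_clinear T"
    using assms by (rule positive_op_clinear)
  have real: "inner (T z) (scaleC \<i> z) = 0" for z
    using assms by (simp add: positive_op_def Im_cinner)
  have "inner (T x) (scaleC \<i> z) + inner (T z) (scaleC \<i> x) = 0" for z
    using real[of "x + z"] real[of x] real[of z]
    by (simp add: clin_add[OF T] scaleC_add_right inner_add_left inner_add_right)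
  from this[of "scaleC \<i> y"] show ?thesis
    by (simp add: clin_scaleC[OF T] scaleC_scaleC scaleC_minus_one inner_scaleC_i_left
        inner_commute[of x])
qed

text \<open>Symmetry makes \<open>inner (T x) (scaleC \<i> x)\<close> its own negative, so the
  quadratic form is real.\<close>

lemma positive_opI:
  assumes "bounded_clinear T" "\<And>x y. inner (T x) y = inner x (T y)" "\<And>x. 0 \<le> inner (T x) x"
  shows "positive_op T"
proof -
  have "inner (T x) (scaleC \<i> x) = 0" for x
    using assms(2)[of x "scaleC \<i> x"]
    by (simp add: clin_scaleC[OF assms(1)] inner_commute[of x] inner_scaleC_i_left)
  with assms show ?thesis
    by (simp add: positive_op_def Im_cinner inner_eq_Re_cinner[symmetric])
qed

lemma adj_positive_op: "positive_op T \<Longrightarrow> adj T = T"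
  by (rule adj_eqI) (simp_all add: positive_op_clinear positive_op_sym)

text \<open>Expand the nonnegative number \<open>inner (T y) y\<close> at
  \<open>y = x - (1 / K) *\<^sub>R T x\<close>.\<close>

lemma norm_square_le_inner:
  assumes T: "positive_op T" and K: "K > 0" "\<And>x. norm (T x) \<le> K * norm x"
  shows "(norm (T x))\<^sup>2 \<le> K * inner (T x) x"
proof -
  let ?n = "(norm (T x))\<^sup>2"
  note lin = positive_op_clinear[OF T]
  have "inner (T (T x)) (T x) \<le> norm (T (T x)) * norm (T x)"
    by (rule norm_cauchy_schwarz)
  also have "\<dots> \<le> K * norm (T x) * norm (T x)"
    by (intro mult_right_mono K) simp
  finally have TT: "inner (T (T x)) (T x) \<le> K * ?n"
    by (simp add: power2_eq_square)
  let ?y = "x - (1 / K) *\<^sub>R T x"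
  have "0 \<le> inner (T ?y) ?y"
    by (rule positive_op_nonneg[OF T])
  also have "\<dots> = inner (T x) x - 2 / K * ?n + (1 / K) * (1 / K) * inner (T (T x)) (T x)"
    by (simp add: clin_diff[OF lin] clin_scaleR[OF lin] inner_diff_left inner_diff_right
        positive_op_sym[OF T, of "T x" x] power2_norm_eq_inner algebra_simps)
  also have "\<dots> \<le> inner (T x) x - 2 / K * ?n + (1 / K) * (1 / K) * (K * ?n)"
    using mult_left_mono[OF TT, of "(1 / K) * (1 / K)"] K(1) by simp
  also have "\<dots> = inner (T x) x - ?n / K"
    using K(1) by (simp add: field_simps)
  finally show ?thesis
    using K(1) by (simp add: field_simps)
qed

lemma positive_op_eq_zero:
  assumes "positive_op T" "inner (T x) x = 0"
  shows "T x = 0"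
proof -
  obtain K where "K > 0" "\<And>x. norm (T x) \<le> K * norm x"
    using clin_bound[OF positive_op_clinear[OF assms(1)]] by blast
  from norm_square_le_inner[OF assms(1) this, of x] show ?thesis
    by (simp add: assms(2))
qed

text \<open>For \<open>0 \<le> T \<le> 1\<close> the square root is \<open>1 - X\<close>, where \<open>X\<close> is the smallest solution of
  \<open>X = (R + X\<^sup>2) / 2\<close> with \<open>R = 1 - T\<close>.  The increments of the fixed point iteration for \<open>X\<close> are
  bounded in norm by those of the same iteration for the number \<open>R = 1\<close>, which increases to \<open>1\<close>.\<close>

primrec sqrt_iter :: "('a::chilbert_space \<Rightarrow> 'a) \<Rightarrow> nat \<Rightarrow> 'a \<Rightarrow> 'a"
  where "sqrt_iter R 0 = (\<lambda>x. 0)"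
  | "sqrt_iter R (Suc n) = (\<lambda>x. (1 / 2) *\<^sub>R (R x + sqrt_iter R n (sqrt_iter R n x)))"

primrec sqrt_majorant :: "nat \<Rightarrow> real"
  where "sqrt_majorant 0 = 0"
  | "sqrt_majorant (Suc n) = (1 + (sqrt_majorant n)\<^sup>2) / 2"

section \<open>Estimates and convergence of the square root iteration\<close>

lemma sqrt_majorant_bounds: "0 \<le> sqrt_majorant n \<and> sqrt_majorant n \<le> 1"
  by (induction n) (simp_all add: power_le_one)

lemma sqrt_majorant_mono: "sqrt_majorant n \<le> sqrt_majorant (Suc n)"
proof -
  have "0 \<le> (1 - sqrt_majorant n)\<^sup>2"
    by simp
  then show ?thesis
    by (simp add: power2_diff)
qed

lemma bounded_clinear_sqrt_iter:
  assumes "bounded_clinear R"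
  shows "bounded_clinear (sqrt_iter R n)"
proof (induction n)
  case 0
  show ?case
    by (rule bounded_clinearI[of _ 0]) (simp_all add: scaleC_zero_right)
next
  case (Suc n)
  have "bounded_clinear (\<lambda>x. sqrt_iter R n (sqrt_iter R n x))"
    using bounded_clinear_compose[OF Suc Suc] by (simp add: o_def)
  then have "bounded_clinear (\<lambda>x. R x - - sqrt_iter R n (sqrt_iter R n x))"
    using bounded_clinear_scaleR[of _ "- 1"] by (intro bounded_clinear_diff assms) fastforce
  then have "bounded_clinear (\<lambda>x. R x + sqrt_iter R n (sqrt_iter R n x))"
    by simp
  then show ?case
    using bounded_clinear_scaleR by auto
qed

lemma norm_sqrt_iter:
  assumes "\<And>x. norm (R x) \<le> norm x"
  shows "norm (sqrt_iter R n x) \<le> sqrt_majorant n * norm x"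
proof (induction n arbitrary: x)
  case (Suc n)
  let ?s = "sqrt_majorant n"
  have "norm (sqrt_iter R n (sqrt_iter R n x)) \<le> ?s * norm (sqrt_iter R n x)"
    by (rule Suc)
  also have "\<dots> \<le> ?s * (?s * norm x)"
    using Suc sqrt_majorant_bounds by (intro mult_left_mono) auto
  finally have "norm (R x + sqrt_iter R n (sqrt_iter R n x)) \<le> norm x + ?s * (?s * norm x)"
    using norm_triangle_mono[OF assms] by blast
  moreover have "norm (sqrt_iter R (Suc n) x) = (1 / 2) * norm (R x + sqrt_iter R n (sqrt_iter R n x))"
    by (simp only: sqrt_iter.simps norm_scaleR)
  ultimately show ?case
    by (simp add: power2_eq_square distrib_right del: sqrt_iter.simps)
qed simp

text \<open>With consecutive iterates \<open>X\<close>, \<open>Y\<close> and majorants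
  \<open>s\<close>, \<open>t\<close>, write \<open>Y Y - X X\<close> as
  \<open>Y (Y - X) + (Y - X) X\<close>. The two terms contribute \<open>t (t - s)\<close> and
  \<open>(t - s) s\<close>, and half their sum is the next majorant increment.\<close>

lemma norm_sqrt_iter_step:
  assumes R: "bounded_clinear R" and le: "\<And>x. norm (R x) \<le> norm x"
  shows "norm (sqrt_iter R (Suc n) x - sqrt_iter R n x)
    \<le> (sqrt_majorant (Suc n) - sqrt_majorant n) * norm x"
proof (induction n arbitrary: x)
  case 0
  show ?case
    using le[of x] by simp
next
  case (Suc n)
  let ?X = "sqrt_iter R n" and ?Y = "sqrt_iter R (Suc n)"
  let ?s = "sqrt_majorant n" and ?t = "sqrt_majorant (Suc n)"
  have st: "0 \<le> ?s" "0 \<le> ?t" "?s \<le> ?t"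
    using sqrt_majorant_bounds sqrt_majorant_mono by blast+
  have Y: "bounded_clinear ?Y"
    using R by (rule bounded_clinear_sqrt_iter)
  have "norm (?Y (?Y x - ?X x)) \<le> ?t * norm (?Y x - ?X x)"
    using le by (rule norm_sqrt_iter)
  also have "\<dots> \<le> ?t * ((?t - ?s) * norm x)"
    by (rule mult_left_mono[OF Suc st(2)])
  finally have 1: "norm (?Y (?Y x - ?X x)) \<le> ?t * ((?t - ?s) * norm x)" .
  have "norm (?Y (?X x) - ?X (?X x)) \<le> (?t - ?s) * norm (?X x)"
    by (rule Suc)
  also have "\<dots> \<le> (?t - ?s) * (?s * norm x)"
    using norm_sqrt_iter[OF le] st by (intro mult_left_mono) auto
  finally have 2: "norm (?Y (?X x) - ?X (?X x)) \<le> (?t - ?s) * (?s * norm x)" .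
  have "sqrt_iter R (Suc (Suc n)) x - ?Y x
      = (1 / 2) *\<^sub>R (?Y (?Y x - ?X x) + (?Y (?X x) - ?X (?X x)))"
    unfolding clin_diff[OF Y]
    by (simp only: sqrt_iter.simps(2)[of R "Suc n"] sqrt_iter.simps(2)[of R n, THEN fun_cong, of x]
        algebra_simps)
  then have "norm (sqrt_iter R (Suc (Suc n)) x - ?Y x)
      \<le> (1 / 2) * (?t * ((?t - ?s) * norm x) + (?t - ?s) * (?s * norm x))"
    using norm_triangle_mono[OF 1 2] by (simp del: sqrt_iter.simps sqrt_majorant.simps)
  also have "\<dots> = (?t\<^sup>2 - ?s\<^sup>2) / 2 * norm x"
    by (simp add: power2_eq_square field_simps del: sqrt_majorant.simps)
  also have "\<dots> = (sqrt_majorant (Suc (Suc n)) - ?t) * norm x"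
    unfolding sqrt_majorant.simps(2)[of "Suc n"]
    by (subst (3) sqrt_majorant.simps(2))
      (simp add: diff_divide_distrib add_divide_distrib del: sqrt_majorant.simps)
  finally show ?case .
qed

lemma sqrt_iter_sym:
  assumes "\<And>x y. inner (R x) y = inner x (R y)"
  shows "inner (sqrt_iter R n x) y = inner x (sqrt_iter R n y)"
  by (induction n arbitrary: x y) (simp_all add: inner_add_left inner_add_right assms)

text \<open>The iterates are polynomials in \<open>R\<close>. In the limit this gives the
  commutation property of the square root on which its uniqueness depends.\<close>

lemma sqrt_iter_commute:
  assumes "bounded_clinear B" "\<And>x. B (R x) = R (B x)"
  shows "B (sqrt_iter R n x) = sqrt_iter R n (B x)"
proof (induction n arbitrary: x)
  case (Suc n)
  then show ?case
    by (simp add: assms(2) clin_add[OF assms(1)] clin_scaleR[OF assms(1)])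
qed (simp add: clin_zero[OF assms(1)])

text \<open>Telescoping compares the differences of the iterates with those of a bounded increasing
  real sequence.\<close>

lemma sqrt_iter_convergent:
  assumes R: "bounded_clinear R" and le: "\<And>x. norm (R x) \<le> norm x"
  shows "convergent (\<lambda>n. sqrt_iter R n x)"
proof -
  let ?s = sqrt_majorant
  have diff: "norm (sqrt_iter R (m + k) x - sqrt_iter R m x) \<le> (?s (m + k) - ?s m) * norm x" for m k
  proof (induction k)
    case (Suc k)
    have "norm (sqrt_iter R (m + Suc k) x - sqrt_iter R m x)
        \<le> norm (sqrt_iter R (Suc (m + k)) x - sqrt_iter R (m + k) x)
          + norm (sqrt_iter R (m + k) x - sqrt_iter R m x)"
      unfolding add_Suc_right by norm
    also have "\<dots> \<le> (?s (Suc (m + k)) - ?s (m + k)) * norm x + (?s (m + k) - ?s m) * norm x"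
      by (intro add_mono norm_sqrt_iter_step R le Suc)
    finally show ?case
      by (simp only: add_Suc_right) (simp only: algebra_simps)
  qed simp
  have "incseq ?s"
    using sqrt_majorant_mono by (rule incseq_SucI)
  then have "convergent ?s"
    using incseq_convergent[of ?s 1] sqrt_majorant_bounds by (metis convergentI)
  then have "Cauchy (\<lambda>n. ?s n * norm x)"
    by (intro convergent_Cauchy convergent_mult convergent_const)
  then have "Cauchy (\<lambda>n. sqrt_iter R n x)"
    unfolding Cauchy_altdef2
  proof (intro allI impI)
    fix e :: real
    assume "\<forall>e>0. \<exists>N. \<forall>n\<ge>N. dist (?s n * norm x) (?s N * norm x) < e" and "0 < e"
    then obtain N where N: "\<And>n. n \<ge> N \<Longrightarrow> dist (?s n * norm x) (?s N * norm x) < e"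
      by blast
    have "dist (sqrt_iter R n x) (sqrt_iter R N x) < e" if "n \<ge> N" for n
    proof -
      have "dist (sqrt_iter R n x) (sqrt_iter R N x) \<le> (?s n - ?s N) * norm x"
        using diff[of N "n - N"] that by (simp add: dist_norm)
      also have "\<dots> \<le> dist (?s n * norm x) (?s N * norm x)"
        by (simp add: dist_real_def left_diff_distrib)
      also have "\<dots> < e"
        using N[OF that] .
      finally show ?thesis .
    qed
    then show "\<exists>N. \<forall>n\<ge>N. dist (sqrt_iter R n x) (sqrt_iter R N x) < e"
      by blast
  qed
  then show ?thesis
    by (rule Cauchy_convergent)
qed

lemma contraction_sqrt_exists:
  assumes T: "positive_op T" and le: "\<And>x. norm (T x) \<le> norm x"
  shows "\<exists>S. positive_op S \<and> S \<circ> S = T \<and>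
    (\<forall>B. bounded_clinear B \<longrightarrow> B \<circ> T = T \<circ> B \<longrightarrow> B \<circ> S = S \<circ> B)"
proof -
  note linT = positive_op_clinear[OF T]
  define R where "R = (\<lambda>x. x - T x)"
  have R: "bounded_clinear R"
    unfolding R_def by (intro bounded_clinear_diff bounded_clinear_id linT)
  have symR: "inner (R x) y = inner x (R y)" for x y
    by (simp add: R_def inner_diff_left inner_diff_right positive_op_sym[OF T])
  \<comment> \<open>For a positive contraction,
    \<open>(norm (T x))\<^sup>2 \<le> inner (T x) x\<close>, which the term
    \<open>- 2 * inner (T x) x\<close> absorbs.\<close>
  have leR: "norm (R x) \<le> norm x" for x
  proof (rule power2_le_imp_le)
    have "(norm (R x))\<^sup>2 = (norm x)\<^sup>2 - 2 * inner (T x) x + (norm (T x))\<^sup>2"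
      by (simp add: R_def power2_norm_eq_inner inner_diff_left inner_diff_right inner_commute)
    then show "(norm (R x))\<^sup>2 \<le> (norm x)\<^sup>2"
      using norm_square_le_inner[OF T, of 1 x] le positive_op_nonneg[OF T, of x] by simp
  qed simp
  define X where "X = sqrt_iter R"
  define Y where "Y x = lim (\<lambda>n. X n x)" for x
  have lim: "(\<lambda>n. X n x) \<longlonglongrightarrow> Y x" for x
    using sqrt_iter_convergent[OF R leR, of x] by (simp add: X_def Y_def convergent_LIMSEQ_iff)
  have X: "bounded_clinear (X n)" for n
    using R by (simp add: X_def bounded_clinear_sqrt_iter)
  have leX: "norm (X n x) \<le> norm x" for n x
  proof -
    have "norm (X n x) \<le> sqrt_majorant n * norm x"
      unfolding X_def using leR by (rule norm_sqrt_iter)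
    also have "\<dots> \<le> norm x"
      using sqrt_majorant_bounds by (intro mult_left_le_one_le) auto
    finally show ?thesis .
  qed
  have leY: "norm (Y x) \<le> norm x" for x
    using tendsto_norm[OF lim[of x]] by (rule LIMSEQ_le_const2) (use leX in blast)
  have Y: "bounded_clinear Y"
  proof (rule bounded_clinearI[of _ 1])
    show "Y (x + y) = Y x + Y y" for x y
      using lim[of "x + y"] tendsto_add[OF lim[of x] lim[of y]]
      unfolding clin_add[OF X] by (rule LIMSEQ_unique)
    show "Y (scaleC c x) = scaleC c (Y x)" for c x
      using lim[of "scaleC c x"] tendsto_scaleC[OF lim[of x]]
      unfolding clin_scaleC[OF X] by (rule LIMSEQ_unique)
  qed (simp add: leY)
  \<comment> \<open>The uniform bound \<open>leX\<close> makes \<open>X n (X n x - Y x)\<close> a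
    null sequence, so pointwise convergence passes to the squares.\<close>
  have XX: "(\<lambda>n. X n (X n x)) \<longlonglongrightarrow> Y (Y x)" for x
  proof -
    have "(\<lambda>n. norm (X n x - Y x)) \<longlonglongrightarrow> 0"
      using lim[of x] by (simp add: LIM_zero tendsto_norm_zero)
    moreover have "\<forall>n. norm (X n (X n x - Y x)) \<le> norm (X n x - Y x)"
      using leX by blast
    ultimately have "(\<lambda>n. X n (X n x - Y x)) \<longlonglongrightarrow> 0"
      by (rule Lim_null_comparison[OF always_eventually, rotated])
    from tendsto_add[OF this lim[of "Y x"]] show ?thesis
      by (simp add: clin_diff[OF X])
  qed
  have fixpoint: "Y x = (1 / 2) *\<^sub>R (R x + Y (Y x))" for x
  proof (rule LIMSEQ_unique)
    show "(\<lambda>n. X (Suc n) x) \<longlonglongrightarrow> Y x"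
      using lim by (rule LIMSEQ_Suc)
    have "(\<lambda>n. (1 / 2) *\<^sub>R (R x + X n (X n x))) \<longlonglongrightarrow> (1 / 2) *\<^sub>R (R x + Y (Y x))"
      by (rule tendsto_scaleR[OF tendsto_const tendsto_add[OF tendsto_const XX]])
    then show "(\<lambda>n. X (Suc n) x) \<longlonglongrightarrow> (1 / 2) *\<^sub>R (R x + Y (Y x))"
      by (simp add: X_def)
  qed
  have symY: "inner (Y x) y = inner x (Y y)" for x y
  proof (rule LIMSEQ_unique)
    show "(\<lambda>n. inner (X n x) y) \<longlonglongrightarrow> inner (Y x) y"
      by (rule tendsto_inner[OF lim tendsto_const])
    have "(\<lambda>n. inner x (X n y)) \<longlonglongrightarrow> inner x (Y y)"
      by (rule tendsto_inner[OF tendsto_const lim])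
    then show "(\<lambda>n. inner (X n x) y) \<longlonglongrightarrow> inner x (Y y)"
      by (simp add: X_def sqrt_iter_sym[OF symR])
  qed
  define S where "S = (\<lambda>x. x - Y x)"
  have S: "bounded_clinear S"
    unfolding S_def by (intro bounded_clinear_diff bounded_clinear_id Y)
  have "positive_op S"
  proof (rule positive_opI[OF S])
    show "inner (S x) y = inner x (S y)" for x y
      by (simp add: S_def inner_diff_left inner_diff_right symY)
    show "0 \<le> inner (S x) x" for x
    proof -
      have "inner (Y x) x \<le> norm (Y x) * norm x"
        by (rule norm_cauchy_schwarz)
      also have "\<dots> \<le> norm x * norm x"
        by (intro mult_right_mono leY) simp
      finally show ?thesis
        by (simp add: S_def inner_diff_left power2_norm_eq_inner[symmetric] power2_eq_square)
    qed
  qed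
  moreover have "S \<circ> S = T"
  proof
    fix x
    have "2 *\<^sub>R Y x = 2 *\<^sub>R ((1 / 2) *\<^sub>R (R x + Y (Y x)))"
      using fixpoint[of x] by (rule arg_cong)
    then have "Y x + Y x = R x + Y (Y x)"
      by (simp add: scaleR_2)
    then show "(S \<circ> S) x = T x"
      by (simp add: S_def R_def clin_diff[OF Y] algebra_simps)
  qed
  moreover have "B \<circ> S = S \<circ> B" if B: "bounded_clinear B" and comm: "B \<circ> T = T \<circ> B" for B
  proof
    fix x
    have BR: "B (R z) = R (B z)" for z
      using comm[THEN fun_cong, of z] by (simp add: R_def clin_diff[OF B])
    have "B (Y x) = Y (B x)"
    proof (rule LIMSEQ_unique)
      show "(\<lambda>n. B (X n x)) \<longlonglongrightarrow> B (Y x)"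
        using B lim by (rule clin_tendsto)
      show "(\<lambda>n. B (X n x)) \<longlonglongrightarrow> Y (B x)"
        using lim[of "B x"] by (simp add: X_def sqrt_iter_commute[where B = B and R = R, OF B BR])
    qed
    then show "(B \<circ> S) x = (S \<circ> B) x"
      by (simp add: S_def clin_diff[OF B])
  qed
  ultimately show ?thesis
    by blast
qed

section \<open>Square roots of arbitrary positive operators\<close>

lemma positive_op_scaleR:
  assumes "positive_op T" "0 \<le> r"
  shows "positive_op (\<lambda>x. r *\<^sub>R T x)"
  using assms
  by (intro positive_opI bounded_clinear_scaleR)
    (simp_all add: positive_op_clinear positive_op_nonneg, simp add: positive_op_sym)

text \<open>Dividing by a bound \<open>K\<close> reduces to a contraction; the factor
  \<open>sqrt K\<close> undoes the scaling.\<close>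

lemma positive_sqrt_exists:
  assumes T: "positive_op T"
  shows "\<exists>S. positive_op S \<and> S \<circ> S = T \<and>
    (\<forall>B. bounded_clinear B \<longrightarrow> B \<circ> T = T \<circ> B \<longrightarrow> B \<circ> S = S \<circ> B)"
proof -
  obtain K where K: "K > 0" "\<And>x. norm (T x) \<le> K * norm x"
    using clin_bound[OF positive_op_clinear[OF T]] by blast
  define T' where "T' = (\<lambda>x. (1 / K) *\<^sub>R T x)"
  have T': "positive_op T'"
    unfolding T'_def using K by (intro positive_op_scaleR T) simp
  have "norm (T' x) \<le> norm x" for x
    using K(2)[of x] K(1) by (simp add: T'_def divide_le_eq mult.commute)
  from contraction_sqrt_exists[OF T' this] obtain S where S: "positive_op S" "S \<circ> S = T'"
    "\<And>B. bounded_clinear B \<Longrightarrow> B \<circ> T' = T' \<circ> B \<Longrightarrow> B \<circ> S = S \<circ> B"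
    by blast
  note linS = positive_op_clinear[OF S(1)]
  let ?S = "\<lambda>x. sqrt K *\<^sub>R S x"
  have "positive_op ?S"
    using K by (intro positive_op_scaleR S) simp
  moreover have "?S \<circ> ?S = T"
  proof
    fix x
    have "S (S x) = (1 / K) *\<^sub>R T x"
      using S(2)[THEN fun_cong, of x] by (simp add: T'_def)
    then show "(?S \<circ> ?S) x = T x"
      using K by (simp add: clin_scaleR[OF linS])
  qed
  moreover have "B \<circ> ?S = ?S \<circ> B" if B: "bounded_clinear B" and comm: "B \<circ> T = T \<circ> B" for B
  proof -
    have "B (T x) = T (B x)" for x
      using comm[THEN fun_cong, of x] by simp
    then have "B \<circ> T' = T' \<circ> B"
      by (simp add: T'_def fun_eq_iff clin_scaleR[OF B])
    with S(3)[OF B] have "B (S x) = S (B x)" for x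
      by (simp add: fun_eq_iff)
    then show ?thesis
      by (simp add: fun_eq_iff clin_scaleR[OF B])
  qed
  ultimately show ?thesis
    by blast
qed

text \<open>\<open>R\<close> commutes with \<open>T = R \<circ> R\<close>, hence with
  \<open>S\<close>, so \<open>(S + R) (S - R) = 0\<close>. For \<open>y = S x - R x\<close> both
  nonnegative forms therefore vanish, whence \<open>S y = R y = 0\<close> and \<open>y\<close> is
  orthogonal to itself.\<close>

lemma positive_sqrt_unique:
  assumes S: "positive_op S" "S \<circ> S = T" and R: "positive_op R" "R \<circ> R = T"
    and comm: "\<And>B. bounded_clinear B \<Longrightarrow> B \<circ> T = T \<circ> B \<Longrightarrow> B \<circ> S = S \<circ> B"
  shows "R = S"
proof
  fix x
  note linS = positive_op_clinear[OF S(1)] and linR = positive_op_clinear[OF R(1)]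
  have "R \<circ> T = T \<circ> R"
    unfolding R(2)[symmetric] by (simp add: comp_assoc)
  with linR have "R \<circ> S = S \<circ> R"
    by (rule comm)
  then have RS: "R (S z) = S (R z)" for z
    by (simp add: fun_eq_iff)
  have sq: "S (S z) = R (R z)" for z
    using S(2) R(2) by (metis comp_apply)
  define y where "y = S x - R x"
  have "S y + R y = 0"
    by (simp add: y_def clin_diff[OF linS] clin_diff[OF linR] RS sq)
  then have "inner (S y) y + inner (R y) y = 0"
    by (simp add: inner_add_left[symmetric])
  then have "inner (S y) y = 0" "inner (R y) y = 0"
    using positive_op_nonneg[OF S(1), of y] positive_op_nonneg[OF R(1), of y] by linarith+
  then have "S y = 0" "R y = 0"
    using S(1) R(1) positive_op_eq_zero by blast+
  have "inner y y = inner (S x) y - inner (R x) y"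
    by (subst (1) y_def) (rule inner_diff_left)
  also have "\<dots> = 0"
    by (simp add: positive_op_sym[OF S(1)] positive_op_sym[OF R(1)] \<open>S y = 0\<close> \<open>R y = 0\<close>)
  finally have "y = 0"
    by simp
  then show "R x = S x"
    by (simp add: y_def)
qed

lemma
  assumes "positive_op T"
  shows positive_op_sqrt_op: "positive_op (sqrt_op T)"
    and sqrt_op_square: "sqrt_op T \<circ> sqrt_op T = T"
    and sqrt_op_unique: "positive_op R \<Longrightarrow> R \<circ> R = T \<Longrightarrow> sqrt_op T = R"
proof -
  obtain S where S: "positive_op S" "S \<circ> S = T"
    "\<And>B. bounded_clinear B \<Longrightarrow> B \<circ> T = T \<circ> B \<Longrightarrow> B \<circ> S = S \<circ> B"
    using positive_sqrt_exists[OF assms] by blast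
  have uniq: "R = S" if "positive_op R" "R \<circ> R = T" for R
    using S(1,2) that S(3) by (rule positive_sqrt_unique)
  have "sqrt_op T = S"
    unfolding sqrt_op_def
  proof (rule the_equality)
    show "positive_op S \<and> S \<circ> S = T"
      using S(1,2) by blast
  qed (use uniq in blast)
  then show "positive_op (sqrt_op T)" "sqrt_op T \<circ> sqrt_op T = T"
    using S(1,2) by simp_all
  show "sqrt_op T = R" if "positive_op R" "R \<circ> R = T"
    using \<open>sqrt_op T = S\<close> uniq[OF that] by simp
qed

section \<open>The polar decomposition\<close>

lemma
  assumes "bounded_clinear T"
  shows csubspace_nullspace: "csubspace (nullspace T)"
    and closed_nullspace: "closed (nullspace T)"
  using orth_range[OF bounded_clinear_adj[OF assms]] adj_adj[OF assms] csubspace_orth closed_orth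
  by metis+

lemma range_subset_orth_nullspace:
  assumes "bounded_clinear T"
  shows "range (adj T) \<subseteq> orth (nullspace T)"
  unfolding orth_nullspace[OF assms] by (rule closure_subset)

lemma positive_op_conjugate:
  assumes T: "bounded_clinear T" and H: "positive_op H"
  shows "positive_op (T \<circ> H \<circ> adj T)"
proof (rule positive_opI)
  show "bounded_clinear (T \<circ> H \<circ> adj T)"
    by (intro bounded_clinear_compose bounded_clinear_adj positive_op_clinear T H)
  show "0 \<le> inner ((T \<circ> H \<circ> adj T) x) x" for x
    using positive_op_nonneg[OF H, of "adj T x"] by (simp add: inner_adj[OF T])
qed (simp add: inner_adj[OF T] positive_op_sym[OF H] inner_adj_left[OF T, symmetric])

lemma positive_op_adj_compose:
  assumes "bounded_clinear T"
  shows "positive_op (adj T \<circ> T)"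
proof (rule positive_opI)
  show "bounded_clinear (adj T \<circ> T)"
    by (intro bounded_clinear_compose bounded_clinear_adj assms)
qed (simp_all add: inner_adj_left[OF assms] inner_adj[OF assms, symmetric])

lemma
  assumes "bounded_clinear T"
  shows positive_op_abs_op: "positive_op (abs_op T)"
    and abs_op_square: "abs_op T \<circ> abs_op T = adj T \<circ> T"
  unfolding abs_op_def using positive_op_adj_compose[OF assms]
  by (rule positive_op_sqrt_op, rule sqrt_op_square)

lemma norm_abs_op:
  assumes "bounded_clinear T"
  shows "norm (abs_op T x) = norm (T x)"
proof -
  have "inner (abs_op T x) (abs_op T x) = inner x ((abs_op T \<circ> abs_op T) x)"
    by (simp add: positive_op_sym[OF positive_op_abs_op[OF assms]])
  also have "\<dots> = inner (T x) (T x)"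
    by (simp add: abs_op_square[OF assms] inner_adj[OF assms])
  finally show ?thesis
    by (simp add: norm_eq_sqrt_inner)
qed

lemma nullspace_abs_op:
  assumes "bounded_clinear T"
  shows "nullspace (abs_op T) = nullspace T"
proof -
  have "abs_op T x = 0 \<longleftrightarrow> T x = 0" for x
    using norm_abs_op[OF assms, of x] by (metis norm_eq_zero)
  then show ?thesis
    by (simp add: nullspace_def)
qed

text \<open>Preservation of norms on the initial space gives preservation of inner products by
  polarization; the component of the test vector in the nullspace contributes to neither
  side.\<close>

lemma partial_isometry_adj:
  assumes U: "partial_isometry U" and x: "x \<in> orth (nullspace U)"
  shows "adj U (U x) = x"
proof (rule inner_left_eqI)
  fix y
  have lin: "bounded_clinear U" and iso: "\<And>x. x \<in> orth (nullspace U) \<Longrightarrow> norm (U x) = norm x"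
    using U by (auto simp: partial_isometry_def)
  let ?M = "orth (nullspace U)"
  define m where "m = orth_proj ?M y"
  have m: "m \<in> ?M"
    unfolding m_def by (rule orth_proj_mem[OF closed_orth csubspace_orth])
  have "y - m \<in> orth ?M"
    unfolding m_def by (rule orth_proj_diff[OF closed_orth csubspace_orth])
  then have "y - m \<in> nullspace U"
    using orth_orth[OF closed_nullspace[OF lin] csubspace_nullspace[OF lin]] by simp
  then have Uy: "U y = U m" and yx: "inner (y - m) x = 0"
    using inner_orth[OF _ x] by (simp add: nullspace_def clin_diff[OF lin], blast)
  have "m + x \<in> ?M"
    using m x csubspace_orth[of "nullspace U"] by (simp add: csubspace_def subspace_add)
  then have "(norm (U m + U x))\<^sup>2 = (norm (m + x))\<^sup>2"
    using iso[of "m + x"] by (simp add: clin_add[OF lin])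
  then have "inner (U m) (U x) = inner m x"
    using iso[OF m] iso[OF x]
    by (simp add: power2_norm_eq_inner[symmetric] dot_norm)
  then show "inner y (adj U (U x)) = inner y x"
    using yx by (simp add: inner_adj[OF lin, symmetric] Uy inner_diff_left)
qed

text \<open>Since \<open>abs_op T x\<close> and \<open>T x\<close> have equal norms, the map from
  one to the other extends to an isometry on the closure of the range of \<open>abs_op T\<close>,
  and by zero on its complement, the nullspace of \<open>T\<close>.\<close>

lemma polar_decomposition_exists:
  assumes T: "bounded_clinear T"
  shows "\<exists>U. partial_isometry U \<and> nullspace U = nullspace T \<and> T = U \<circ> abs_op T"
proof -
  let ?H = "abs_op T" and ?N = "nullspace T"
  have H: "positive_op ?H"
    using T by (rule positive_op_abs_op)
  note linH = positive_op_clinear[OF H]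
  have "norm (T x) \<le> 1 * norm (?H x)" for x
    by (simp add: norm_abs_op[OF T])
  from factor_through_extension[OF linH T this] obtain U where
    U: "bounded_clinear U" "U \<circ> ?H = T" "\<And>x. x \<in> orth (range ?H) \<Longrightarrow> U x = 0"
    by blast
  have rangeH: "orth (range ?H) = ?N" "orth ?N = closure (range ?H)"
    using orth_range[OF linH] orth_nullspace[OF linH]
    by (simp_all add: adj_positive_op[OF H] nullspace_abs_op[OF T])
  have "closure (range ?H) \<subseteq> {x. norm (U x) = norm x}"
  proof (rule closure_minimal)
    show "range ?H \<subseteq> {x. norm (U x) = norm x}"
      using U(2)[THEN fun_cong] norm_abs_op[OF T] by auto
    show "closed {x. norm (U x) = norm x}"
      by (intro closed_Collect_eq continuous_intros clin_continuous_on U)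
  qed
  then have iso: "norm (U x) = norm x" if "x \<in> orth ?N" for x
    using that rangeH by auto
  have "nullspace U = ?N"
  proof
    show "?N \<subseteq> nullspace U"
      using U(3) rangeH(1) by (auto simp: nullspace_def)
    show "nullspace U \<subseteq> ?N"
    proof
      fix x assume "x \<in> nullspace U"
      let ?p = "orth_proj ?N x"
      note N = closed_nullspace[OF T] csubspace_nullspace[OF T]
      have "?p \<in> nullspace U"
        using orth_proj_mem[OF N] \<open>?N \<subseteq> nullspace U\<close> by blast
      with \<open>x \<in> nullspace U\<close> have "U (x - ?p) = 0"
        by (simp add: nullspace_def clin_diff[OF U(1)])
      then have "x - ?p = 0"
        using iso[OF orth_proj_diff[OF N, of x]] by simp
      then show "x \<in> ?N"
        using orth_proj_mem[OF N, of x] by simp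
    qed
  qed
  moreover have "partial_isometry U"
    unfolding partial_isometry_def \<open>nullspace U = ?N\<close> using U(1) iso by blast
  ultimately show ?thesis
    using U(2)[symmetric] by blast
qed

lemma conjugate_square:
  assumes U: "partial_isometry U" and H: "range H \<subseteq> orth (nullspace U)"
  shows "(U \<circ> H \<circ> adj U) \<circ> (U \<circ> H \<circ> adj U) = U \<circ> (H \<circ> H) \<circ> adj U"
proof -
  have "adj U (U (H y)) = H y" for y
    by (rule partial_isometry_adj[OF U]) (use H in blast)
  then show ?thesis
    by (simp add: fun_eq_iff)
qed

text \<open>Dual to \<open>partial_isometry_adj\<close>: \<open>adj U \<circ> U\<close> fixes the
  range of \<open>H\<close>, so the self-adjoint \<open>H\<close> absorbs it on the right as
  well.\<close>

lemma positive_adj_partial_isometry: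
  assumes U: "partial_isometry U" and H: "positive_op H" "range H \<subseteq> orth (nullspace U)"
  shows "H (adj U (U x)) = H x"
proof (rule inner_left_eqI)
  have lin: "bounded_clinear U"
    using U by (simp add: partial_isometry_def)
  fix y
  have "inner y (H (adj U (U x))) = inner (U (H y)) (U x)"
    by (simp add: positive_op_sym[OF H(1), symmetric] inner_adj[OF lin])
  also have "\<dots> = inner (adj U (U (H y))) x"
    by (rule inner_adj_left[OF lin, symmetric])
  also have "adj U (U (H y)) = H y"
    by (rule partial_isometry_adj[OF U]) (use H in blast)
  finally show "inner y (H (adj U (U x))) = inner y (H x)"
    by (simp add: positive_op_sym[OF H(1)])
qed

text \<open>The right-hand side is positive and its square is \<open>T \<circ> adj T\<close>;
  positive roots are unique.\<close>

lemma abs_op_adj: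
  assumes T: "bounded_clinear T" and U: "partial_isometry U" "nullspace U = nullspace T"
    and polar: "T = U \<circ> abs_op T"
  shows "abs_op (adj T) = U \<circ> abs_op T \<circ> adj U"
proof -
  let ?H = "abs_op T"
  have lin: "bounded_clinear U"
    using U by (simp add: partial_isometry_def)
  have H: "positive_op ?H"
    using T by (rule positive_op_abs_op)
  note linH = positive_op_clinear[OF H]
  have "range ?H \<subseteq> orth (nullspace U)"
    using range_subset_orth_nullspace[OF linH]
    by (simp add: U(2) adj_positive_op[OF H] nullspace_abs_op[OF T])
  from conjugate_square[OF U(1) this]
  have "(U \<circ> ?H \<circ> adj U) \<circ> (U \<circ> ?H \<circ> adj U) = (U \<circ> ?H) \<circ> (adj ?H \<circ> adj U)"
    by (simp add: comp_assoc adj_positive_op[OF H])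
  also have "\<dots> = T \<circ> adj T"
    using adj_compose[OF lin linH] polar by simp
  also have "\<dots> = adj (adj T) \<circ> adj T"
    by (simp add: adj_adj[OF T])
  finally show ?thesis
    unfolding abs_op_def[of "adj T"]
    by (intro sqrt_op_unique positive_op_adj_compose bounded_clinear_adj T
        positive_op_conjugate lin H)
qed

text \<open>The final space of \<open>V\<close> is the closure of the range of \<open>T\<close>: on the nullspace of \<open>|T\<^sup>*|\<close> the
  adjoint of \<open>V\<close> vanishes because \<open>V V\<^sup>*\<close> fixes the range of \<open>|T\<^sup>*|\<close>, so that
  \<open>T V\<^sup>* = |T\<^sup>*| V V\<^sup>*\<close> vanishes there.\<close>

lemma polar_adj_vanishes:
  assumes T: "bounded_clinear T" and V: "partial_isometry V" "nullspace V = nullspace T"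
    and polar: "T = abs_op (adj T) \<circ> V" and z: "abs_op (adj T) z = 0"
  shows "adj V z = 0"
proof -
  let ?P = "abs_op (adj T)"
  note T' = bounded_clinear_adj[OF T]
  have P: "positive_op ?P"
    using T' by (rule positive_op_abs_op)
  have lin: "bounded_clinear V" and iso: "\<And>x. x \<in> orth (nullspace V) \<Longrightarrow> norm (V x) = norm x"
    using V by (auto simp: partial_isometry_def)
  have orthV: "adj V y \<in> orth (nullspace V)" for y
    using range_subset_orth_nullspace[OF lin] by blast
  \<comment> \<open>Equality case of Cauchy-Schwarz: both vectors have the same norm, and their
    inner product is the square of that norm.\<close>
  have VP: "V (adj V (?P y)) = ?P y" for y
  proof -
    have "adj T = adj V \<circ> ?P"
      using adj_compose[OF positive_op_clinear[OF P] lin] polar adj_positive_op[OF P] by simp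
    then have "norm (adj V (?P y)) = norm (?P y)"
      using norm_abs_op[OF T', of y] by (metis comp_apply)
    moreover have "norm (V (adj V (?P y))) = norm (adj V (?P y))"
      by (rule iso[OF orthV])
    moreover have "inner (V (adj V (?P y))) (?P y) = (norm (adj V (?P y)))\<^sup>2"
      by (simp add: inner_adj[OF lin] power2_norm_eq_inner)
    moreover have "(norm (v - w))\<^sup>2 = (norm v)\<^sup>2 - 2 * inner v w + (norm w)\<^sup>2" for v w :: 'b
      by (simp add: power2_norm_eq_inner inner_diff_left inner_diff_right inner_commute)
    note this[of "V (adj V (?P y))" "?P y"]
    ultimately show ?thesis
      by simp
  qed
  have "?P (V (adj V z)) = 0"
  proof (rule inner_left_eqI)
    fix y
    have "inner y (?P (V (adj V z))) = inner (V (adj V (?P y))) z"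
      by (simp add: positive_op_sym[OF P, symmetric] inner_adj[OF lin])
        (simp add: inner_adj_left[OF lin, symmetric])
    also have "\<dots> = 0"
      by (simp add: VP positive_op_sym[OF P] z)
    finally show "inner y (?P (V (adj V z))) = inner y 0"
      by simp
  qed
  then have "adj V z \<in> nullspace T"
    using polar[THEN fun_cong, of "adj V z"] by (simp add: nullspace_def)
  then show ?thesis
    using orthV[of z] V(2) orth_self by blast
qed

text \<open>Compare adjoints: both send \<open>?P y\<close> to \<open>adj T y\<close>, so they agree
  on the closure of the range of \<open>?P\<close>, and both vanish on its nullspace.\<close>

lemma polar_unique:
  assumes T: "bounded_clinear T"
    and U: "partial_isometry U" "nullspace U = nullspace T" "T = abs_op (adj T) \<circ> U"
    and V: "partial_isometry V" "nullspace V = nullspace T" "T = abs_op (adj T) \<circ> V"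
  shows "U = V"
proof -
  let ?P = "abs_op (adj T)"
  note T' = bounded_clinear_adj[OF T]
  have P: "positive_op ?P"
    using T' by (rule positive_op_abs_op)
  note linP = positive_op_clinear[OF P]
  have lin: "bounded_clinear U" "bounded_clinear V"
    using U V by (auto simp: partial_isometry_def)
  note lin' = lin[THEN bounded_clinear_adj]
  have "adj U \<circ> ?P = adj T" "adj V \<circ> ?P = adj T"
    using adj_compose[OF linP lin(1)] adj_compose[OF linP lin(2)] U(3) V(3) adj_positive_op[OF P]
    by simp_all
  then have "range ?P \<subseteq> {y. adj U y = adj V y}"
    by (auto simp: fun_eq_iff)
  then have "closure (range ?P) \<subseteq> {y. adj U y = adj V y}"
    by (rule closure_minimal) (intro closed_Collect_eq clin_continuous_on lin')
  then have on_range: "adj U y = adj V y" if "y \<in> orth (nullspace ?P)" for y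
    using that orth_nullspace[OF linP] adj_positive_op[OF P] by auto
  have "adj U y = adj V y" for y
  proof -
    note N = closed_nullspace[OF linP] csubspace_nullspace[OF linP]
    let ?p = "orth_proj (nullspace ?P) y"
    have "?P ?p = 0"
      using orth_proj_mem[OF N, of y] by (simp add: nullspace_def)
    then have "adj U ?p = 0" "adj V ?p = 0"
      using polar_adj_vanishes[OF T] U V by blast+
    moreover have "adj U (y - ?p) = adj V (y - ?p)"
      by (rule on_range[OF orth_proj_diff[OF N]])
    ultimately show ?thesis
      by (simp add: clin_diff[OF lin'(1)] clin_diff[OF lin'(2)])
  qed
  then have "adj (adj U) = adj (adj V)"
    by (intro arg_cong[where f = adj] ext)
  then show ?thesis
    by (simp only: adj_adj lin)
qed

lemma
  assumes T: "bounded_clinear T"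
  shows partial_isometry_polar_factor: "partial_isometry (polar_factor T)"
    and nullspace_polar_factor: "nullspace (polar_factor T) = nullspace T"
    and polar_decomposition: "T = polar_factor T \<circ> abs_op T"
proof -
  obtain U where U: "partial_isometry U" "nullspace U = nullspace T" "T = U \<circ> abs_op T"
    using polar_decomposition_exists[OF T] by blast
  have H: "positive_op (abs_op T)"
    using T by (rule positive_op_abs_op)
  have range: "range (abs_op T) \<subseteq> orth (nullspace U)"
    using range_subset_orth_nullspace[OF positive_op_clinear[OF H]]
    by (simp add: U(2) adj_positive_op[OF H] nullspace_abs_op[OF T])
  \<comment> \<open>This passes from \<open>T = U |T|\<close> to the left-hand form by which
    \<open>polar_factor\<close> is defined.\<close>
  have "abs_op (adj T) \<circ> U = U \<circ> abs_op T"
    unfolding abs_op_adj[OF T U]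
    by (simp add: fun_eq_iff positive_adj_partial_isometry[OF U(1) H range])
  with U(3) have left: "T = abs_op (adj T) \<circ> U"
    by (rule trans[OF _ sym])
  have "polar_factor T = U"
    unfolding polar_factor_def
  proof (rule the_equality)
    show "partial_isometry U \<and> nullspace U = nullspace T \<and> T = abs_op (adj T) \<circ> U"
      using U(1,2) left by blast
    show "V = U"
      if "partial_isometry V \<and> nullspace V = nullspace T \<and> T = abs_op (adj T) \<circ> V" for V
      using that by (intro polar_unique[OF T _ _ _ U(1,2) left]) blast+
  qed
  show "partial_isometry (polar_factor T)" "nullspace (polar_factor T) = nullspace T"
    "T = polar_factor T \<circ> abs_op T"
    unfolding \<open>polar_factor T = U\<close> by (rule U)+
qed

section \<open>The shorted operator of a complementable operator\<close>

text \<open>Evaluates the possibly unbounded inverse at vectors of the range, the only arguments at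
  which \<open>shorted_eq\<close> evaluates it.\<close>

lemma moore_penrose_eqI:
  assumes T: "bounded_clinear T" and x: "x \<in> orth (nullspace T)"
  shows "moore_penrose T (T x) = x"
  unfolding moore_penrose_def
proof (rule the_equality)
  show "x \<in> orth (nullspace T) \<and> T x - T x \<in> orth (range T)"
    using x orth_zero by simp
  fix y assume y: "y \<in> orth (nullspace T) \<and> T x - T y \<in> orth (range T)"
  have "T (x - y) \<in> orth (range T)"
    using y by (simp add: clin_diff[OF T])
  then have "T (x - y) = 0"
    by (rule orth_self[OF rangeI])
  then have "x - y \<in> nullspace T"
    by (simp add: nullspace_def)
  moreover have "x - y \<in> orth (nullspace T)"
    using x y by (simp add: orth_diff)
  ultimately have "x - y = 0"
    by (rule orth_self)
  then show "y = x"
    by simp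
qed

lemma bounded_clinear_block:
  assumes "closed S" "csubspace S" "closed V" "csubspace V" "bounded_clinear T"
  shows "bounded_clinear (block S V T)"
  unfolding block_def by (intro bounded_clinear_compose bounded_clinear_orth_proj assms)

text \<open>Any bounded factors \<open>X\<close> and \<open>Y\<close> serve, since the correction
  term depends on them only through \<open>Y \<circ> e \<circ> X\<close>. Both directions of the
  equivalence use this formula.\<close>

lemma shorted_eq:
  assumes S: "closed S" "csubspace S" and V: "closed V" "csubspace V" and T: "bounded_clinear T"
    and X: "bounded_clinear X" "block S (orth V) T = block (orth S) (orth V) T \<circ> X"
    and Y: "bounded_clinear Y" "block (orth S) V T = Y \<circ> block (orth S) (orth V) T"
  shows "shorted S V T = (\<lambda>x. block S V T x - block (orth S) V T (X x))"
proof -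
  define e where "e = block (orth S) (orth V) T"
  define u where "u = polar_factor e"
  define h where "h = sqrt_op (abs_op e)"
  have e: "bounded_clinear e"
    unfolding e_def by (intro bounded_clinear_block closed_orth csubspace_orth T)
  have H: "positive_op (abs_op e)"
    using e by (rule positive_op_abs_op)
  have h: "positive_op h" "h \<circ> h = abs_op e"
    unfolding h_def using H by (rule positive_op_sqrt_op, rule sqrt_op_square)
  note linh = positive_op_clinear[OF h(1)]
  have u: "partial_isometry u" "nullspace u = nullspace e" "e = u \<circ> abs_op e"
    unfolding u_def
    by (rule partial_isometry_polar_factor[OF e] nullspace_polar_factor[OF e]
        polar_decomposition[OF e])+
  have linu: "bounded_clinear u"
    using u(1) by (simp add: partial_isometry_def)
  have orth_h: "h y \<in> orth (nullspace h)" for y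
    using range_subset_orth_nullspace[OF linh] adj_positive_op[OF h(1)] by auto
  have "nullspace h \<subseteq> nullspace (abs_op e)"
    unfolding h(2)[symmetric] by (auto simp: nullspace_def clin_zero[OF linh])
  moreover have "nullspace (abs_op e) \<subseteq> nullspace h"
  proof
    fix x assume "x \<in> nullspace (abs_op e)"
    then have "h (h x) = 0"
      unfolding h(2)[symmetric] by (simp add: nullspace_def)
    then have "h x \<in> nullspace h"
      by (simp add: nullspace_def)
    then have "h x = 0"
      using orth_h[of x] orth_self by blast
    then show "x \<in> nullspace h"
      by (simp add: nullspace_def)
  qed
  ultimately have null_h: "nullspace h = nullspace u"
    using nullspace_abs_op[OF e] u(2) by simp
  have range_h: "range h \<subseteq> orth (nullspace u)"
    using orth_h null_h by auto
  have "abs_op (adj e) = u \<circ> (h \<circ> h) \<circ> adj u"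
    using abs_op_adj[OF e u] h(2) by simp
  then have "sqrt_op (abs_op (adj e)) = u \<circ> h \<circ> adj u"
    using conjugate_square[OF u(1) range_h]
    by (intro sqrt_op_unique positive_op_abs_op bounded_clinear_adj e positive_op_conjugate linu h)
      simp
  \<comment> \<open>The operator inverted in the definition of \<open>f\<close> is thus
    \<open>u \<circ> h\<close>, whose nullspace is that of \<open>h\<close>.\<close>
  then have sqrt_u: "sqrt_op (abs_op (adj e)) \<circ> u = u \<circ> h"
    by (simp add: fun_eq_iff positive_adj_partial_isometry[OF u(1) h(1) range_h])
  have null_uh: "nullspace (u \<circ> h) = nullspace h"
  proof -
    have "h x = 0" if "u (h x) = 0" for x
    proof -
      have "h x \<in> nullspace u"
        using that by (simp add: nullspace_def)
      then show ?thesis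
        using range_h orth_self by blast
    qed
    then show ?thesis
      by (auto simp: nullspace_def clin_zero[OF linu])
  qed
  have e_uhh: "e x = u (h (h x))" for x
    using u(3) h(2) by (metis comp_apply)
  \<comment> \<open>\<open>e y\<close> is the image of \<open>h y\<close> under
    \<open>u \<circ> h\<close>, and \<open>h y\<close> is orthogonal to the nullspace.\<close>
  have f: "moore_penrose (u \<circ> h) (e y) = h y" for y
    using moore_penrose_eqI[of "u \<circ> h" "h y"] orth_h null_uh
    by (simp add: bounded_clinear_compose linu linh e_uhh)
  have "adj (u \<circ> abs_op e) = adj (abs_op e) \<circ> adj u"
    using linu positive_op_clinear[OF H] by (rule adj_compose)
  then have "adj e = h \<circ> h \<circ> adj u"
    using u(3) h(2) adj_positive_op[OF H] by simp
  then have "moore_penrose h (adj e y) = h (adj u y)" for y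
    using moore_penrose_eqI[OF linh orth_h] by simp
  then have "moore_penrose h \<circ> adj (Y \<circ> e) = h \<circ> adj u \<circ> adj Y"
    by (simp add: adj_compose[OF Y(1) e] fun_eq_iff)
  moreover have "adj (h \<circ> adj u \<circ> adj Y) = Y \<circ> (u \<circ> h)"
    by (simp add: adj_compose bounded_clinear_compose bounded_clinear_adj linh linu Y(1) adj_adj
        adj_positive_op[OF h(1)])
  ultimately have "adj (moore_penrose h \<circ> adj (Y \<circ> e)) (moore_penrose (u \<circ> h) (e (X x)))
      = (Y \<circ> e) (X x)" for x
    by (simp add: f) (simp add: e_uhh)
  then show ?thesis
    unfolding shorted_def Let_def X(2) Y(2) e_def[symmetric] u_def[symmetric] h_def[symmetric] sqrt_u
    by (simp add: fun_eq_iff)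
qed

section \<open>The minus order\<close>

lemma minus_le_imp:
  assumes A: "bounded_clinear A" and B: "bounded_clinear B" and "minus_le A B"
  shows "complementable (closure (range (adj A))) (closure (range A)) B \<and>
    shorted (closure (range (adj A))) (closure (range A)) B = A"
proof -
  obtain Q' Q where Q': "bounded_clinear Q'" "\<And>y. Q' (Q' y) = Q' y"
    and Q: "bounded_clinear Q" "\<And>x. Q (Q x) = Q x"
    and AB: "\<And>x. A x = Q' (B x)" "\<And>x. A x = B (Q x)"
    using \<open>minus_le A B\<close> unfolding minus_le_def projection_def fun_eq_iff comp_apply by blast
  define S where "S = closure (range (adj A))"
  define V where "V = closure (range A)"
  have S: "closed S" "csubspace S" and V: "closed V" "csubspace V"
    unfolding S_def V_def by (auto intro: csubspace_closure csubspace_range bounded_clinear_adj A)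
  let ?P = "orth_proj S" and ?R = "orth_proj V"
  note P = bounded_clinear_orth_proj[OF S] and R = bounded_clinear_orth_proj[OF V]
  have orthS: "orth S = nullspace A"
    unfolding S_def orth_closure orth_range[OF bounded_clinear_adj[OF A]] adj_adj[OF A] ..
  have RA: "?R (A x) = A x" for x
    using closure_subset[of "range A"] by (intro orth_proj_id V) (auto simp: V_def)
  have AP: "A (?P x) = A x" for x
    using orth_proj_diff[OF S, of x] by (simp add: orthS nullspace_def clin_diff[OF A])
  define X where "X = (\<lambda>x. ?P x - Q (?P x))"
  define Y where "Y = (\<lambda>y. ?R y - ?R (Q' y))"
  have X: "bounded_clinear X" and Y: "bounded_clinear Y"
    using bounded_clinear_compose[OF Q(1) P] bounded_clinear_compose[OF R Q'(1)]
    by (auto simp: X_def Y_def o_def intro: bounded_clinear_diff P R)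
  \<comment> \<open>\<open>A (1 - Q) = B Q (1 - Q) = 0\<close>, so \<open>X\<close> maps into
    \<open>orth S\<close>, the nullspace of \<open>A\<close>.\<close>
  have "A (X x) = 0" for x
    by (simp add: X_def clin_diff[OF A] AB(2)[of "Q _"] Q(2)) (simp add: AB(2))
  then have NX: "orth_proj (orth S) (X x) = X x" for x
    by (intro orth_proj_id closed_orth csubspace_orth) (simp add: orthS nullspace_def)
  have BX: "B (X x) = B (?P x) - A x" for x
    by (simp add: X_def clin_diff[OF B] AB(2)[symmetric] AP)
  have d: "block S (orth V) B = block (orth S) (orth V) B \<circ> X"
    by (simp add: fun_eq_iff block_def NX BX orth_proj_orth[OF V] clin_diff[OF R] RA)
  \<comment> \<open>\<open>Q'\<close> fixes the range of \<open>A\<close> and, by continuity, all of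
    \<open>V\<close>; hence \<open>Y\<close> annihilates \<open>V\<close>.\<close>
  have "range A \<subseteq> {y. Q' y = y}"
    by (auto simp: AB(1) Q'(2))
  then have "V \<subseteq> {y. Q' y = y}"
    unfolding V_def
    by (rule closure_minimal)
      (intro closed_Collect_eq clin_continuous_on Q'(1) continuous_on_id)
  then have "Q' (?R y) = ?R y" for y
    using orth_proj_mem[OF V] by blast
  then have YR: "Y (?R y) = 0" for y
    by (simp add: Y_def)
  have "A (orth_proj (orth S) x) = 0" for x
    by (simp add: orth_proj_orth[OF S] clin_diff[OF A] AP)
  \<comment> \<open>On \<open>orth S\<close> the operator \<open>A = Q' B\<close> vanishes, so there
    \<open>Y B\<close> is just the \<open>V\<close> component of \<open>B\<close>.\<close>
  then have c: "block (orth S) V B = Y \<circ> block (orth S) (orth V) B"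
    by (simp add: fun_eq_iff block_def orth_proj_orth[OF V] clin_diff[OF Y] YR)
      (simp add: Y_def AB(1)[symmetric] clin_zero[OF R])
  have e: "bounded_clinear (block (orth S) (orth V) B)"
    by (intro bounded_clinear_block closed_orth csubspace_orth B)
  have "complementable S V B"
    unfolding complementable_def Let_def d c adj_compose[OF Y e] by auto
  moreover have "shorted S V B = A"
    unfolding shorted_eq[OF S V B X d Y c]
    by (simp add: fun_eq_iff block_def NX BX clin_diff[OF R] RA)
  ultimately show ?thesis
    by (simp add: S_def V_def)
qed

text \<open>Holds for arbitrary closed subspaces: complementability alone puts the shorted operator
  below \<open>B\<close>.\<close>

lemma complementable_imp_minus_le:
  assumes S: "closed S" "csubspace S" and V: "closed V" "csubspace V" and B: "bounded_clinear B"
    and "complementable S V B"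
  shows "minus_le (shorted S V B) B"
proof -
  let ?P = "orth_proj S" and ?R = "orth_proj V"
  let ?M = "orth_proj (orth S)" and ?N = "orth_proj (orth V)"
  note P = bounded_clinear_orth_proj[OF S] and R = bounded_clinear_orth_proj[OF V]
  note M = bounded_clinear_orth_proj[OF closed_orth csubspace_orth, of S]
  note N = bounded_clinear_orth_proj[OF closed_orth csubspace_orth, of V]
  define b c d e where "b = block S V B" and "c = block (orth S) V B"
    and "d = block S (orth V) B" and "e = block (orth S) (orth V) B"
  have lin: "bounded_clinear c" "bounded_clinear d" "bounded_clinear e"
    unfolding c_def d_def e_def by (intro bounded_clinear_block closed_orth csubspace_orth S V B)+
  have sub: "range (adj c) \<subseteq> range (adj e)" "range d \<subseteq> range e"
    using \<open>complementable S V B\<close> by (auto simp: complementable_def Let_def c_def d_def e_def)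
  obtain X where X: "bounded_clinear X" "d = e \<circ> X"
    using douglas_factorization[OF lin(2,3) sub(2)] by blast
  \<comment> \<open>The inclusion for \<open>adj c\<close> factors \<open>adj c\<close> through
    \<open>adj e\<close>; taking adjoints moves the factor to the left of \<open>e\<close>.\<close>
  obtain Z where Z: "bounded_clinear Z" "adj c = adj e \<circ> Z"
    using douglas_factorization[OF lin(1,3)[THEN bounded_clinear_adj] sub(1)] by blast
  define Y where "Y = adj Z"
  have Y: "bounded_clinear Y"
    unfolding Y_def using Z(1) by (rule bounded_clinear_adj)
  have cY: "c = Y \<circ> e"
    using adj_compose[OF bounded_clinear_adj[OF lin(3)] Z(1)] Z(2) adj_adj[OF lin(1)] adj_adj[OF lin(3)]
    by (simp add: Y_def)
  have shorted: "shorted S V B = (\<lambda>x. b x - c (X x))"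
    unfolding b_def c_def
    by (rule shorted_eq[OF S V B X(1) _ Y]) (use X(2) cY in \<open>simp_all add: c_def d_def e_def\<close>)
  have PP: "?P (?P x) = ?P x" and RR: "?R (?R y) = ?R y" for x y
    by (simp_all add: orth_proj_id orth_proj_mem S V)
  have split: "B x = B (?P x) + B (?M x)" for x
    by (simp add: orth_proj_orth[OF S] clin_diff[OF B])
  \<comment> \<open>\<open>Q\<close> projects along \<open>orth S\<close> onto the vectors
    \<open>s - ?M (X s)\<close> with \<open>s\<close> in \<open>S\<close>, which \<open>B\<close>
    maps into \<open>V\<close> because \<open>d = e \<circ> X\<close>.\<close>
  define Q where "Q = (\<lambda>x. ?P x - ?M (X (?P x)))"
  \<comment> \<open>\<open>Q'\<close> projects onto \<open>V\<close> along the vectors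
    \<open>w + ?R (Y w)\<close> with \<open>w\<close> in \<open>orth V\<close>.\<close>
  define Q' where "Q' = (\<lambda>y. ?R y - ?R (Y (?N y)))"
  have PQ: "?P (Q x) = ?P x" for x
    by (simp add: Q_def orth_proj_orth[OF S] clin_diff[OF P] PP)
  have RQ': "?R (Q' y) = Q' y" for y
    by (simp add: Q'_def clin_diff[OF R] RR)
  have "projection Q"
    unfolding projection_def
  proof
    show "bounded_clinear Q"
      using bounded_clinear_compose[OF M bounded_clinear_compose[OF X(1) P]]
      by (auto simp: Q_def o_def intro: bounded_clinear_diff P)
    have "Q (Q x) = ?P (Q x) - ?M (X (?P (Q x)))" for x
      by (simp only: Q_def)
    then have "Q (Q x) = Q x" for x
      by (simp only: PQ) (simp only: Q_def)
    then show "Q \<circ> Q = Q"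
      by (simp add: fun_eq_iff)
  qed
  moreover have "projection Q'"
    unfolding projection_def
  proof
    show "bounded_clinear Q'"
      using bounded_clinear_compose[OF R bounded_clinear_compose[OF Y N]]
      by (auto simp: Q'_def o_def intro: bounded_clinear_diff R)
    have "?N (Q' y) = 0" for y
      by (simp add: orth_proj_orth[OF V] RQ')
    then have "Q' (Q' y) = Q' y" for y
      using RQ'[of y] by (simp add: Q'_def[THEN fun_cong, of "Q' y"] clin_zero[OF Y] clin_zero[OF R])
    then show "Q' \<circ> Q' = Q'"
      by (simp add: fun_eq_iff)
  qed
  moreover have "shorted S V B = B \<circ> Q"
  proof
    fix x
    \<comment> \<open>The block \<open>d\<close> sees only the \<open>S\<close> component of its
      argument, so \<open>e \<circ> X\<close> does too.\<close>
    have eX: "e (X (?P x)) = d x"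
      using X(2)[THEN fun_cong, of "?P x"] by (simp add: d_def block_def PP)
    have "?N (B (Q x)) = d x - e (X (?P x))"
      by (simp add: Q_def clin_diff[OF B] clin_diff[OF N] d_def e_def block_def)
    then have "?N (B (Q x)) = 0"
      by (simp add: eX)
    then have "B (Q x) = ?R (B (Q x))"
      by (simp add: orth_proj_orth[OF V])
    also have "\<dots> = b x - c (X (?P x))"
      by (simp add: Q_def clin_diff[OF B] clin_diff[OF R] b_def c_def block_def)
    also have "c (X (?P x)) = c (X x)"
      using X(2)[THEN fun_cong, of x] by (simp add: cY eX)
    finally show "shorted S V B x = (B \<circ> Q) x"
      by (simp add: shorted)
  qed
  moreover have "shorted S V B = Q' \<circ> B"
  proof
    fix x
    have Rc: "?R (c z) = c z" for z
      by (simp add: c_def block_def RR)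
    have "?R (Y (d x)) = c (X x)"
      using X(2) cY Rc[of "X x"] by simp
    moreover have "?R (Y (e x)) = c x"
      using cY Rc[of x] by simp
    moreover have "?N (B x) = d x + e x" "?R (B x) = b x + c x"
      by (simp_all add: split[of x] clin_add[OF N] clin_add[OF R] b_def c_def d_def e_def block_def)
    ultimately show "shorted S V B x = (Q' \<circ> B) x"
      by (simp add: shorted Q'_def clin_add[OF Y] clin_add[OF R])
  qed
  ultimately show ?thesis
    unfolding minus_le_def by blast
qed

theorem theorem3p4:
  fixes A B :: "'a::chilbert_space \<Rightarrow> 'b::chilbert_space"
  assumes "bounded_clinear A" and "bounded_clinear B"
  shows "minus_le A B \<longleftrightarrow>
    complementable (closure (range (adj A))) (closure (range A)) B \<and>
    shorted (closure (range (adj A))) (closure (range A)) B = A"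
proof
  show "minus_le A B \<Longrightarrow> complementable (closure (range (adj A))) (closure (range A)) B \<and>
    shorted (closure (range (adj A))) (closure (range A)) B = A"
    using assms by (rule minus_le_imp)
next
  assume R: "complementable (closure (range (adj A))) (closure (range A)) B \<and>
    shorted (closure (range (adj A))) (closure (range A)) B = A"
  have "minus_le (shorted (closure (range (adj A))) (closure (range A)) B) B"
    using assms R
    by (intro complementable_imp_minus_le closed_closure csubspace_closure csubspace_range
        bounded_clinear_adj) auto
  with R show "minus_le A B"
    by simp
qed

end
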